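(* For every integer $k\ge1$, $$\frac{(q,q^{2k+2},q^{2k+3};q^{2k+3})_\infty}{(q)_\infty^{2k+1}}=\sum_{n_1,n_2,\dots,n_{2k}\ge0}\frac{q^{\sum_{i=1}^{2k-1}n_in_{i+1}+\sum_{i=1}^{2k}n_i}}{(q)_{n_1}^2(q)_{n_2}^2\cdots(q)_{n_{2k}}^2}.$$
   Context: Here $|q|<1$; $(q)_n:=\prod_{j=1}^n(1-q^j)$ for $n\ge0$ and $(q)_\infty:=\prod_{j\ge1}(1-q^j)$. For a base $p$ with $|p|<1$, $(a;p)_\infty:=\prod_{j\ge0}(1-ap^j)$ and $(a,b,c;p)_\infty:=(a;p)_\infty(b;p)_\infty(c;p)_\infty$. *)

theory Defs
  imports "HOL-Analysis.Analysis"
begin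

(* (a;p)_inf, for |p| < 1.  The library's prodinf also covers products with finitely many
   vanishing factors (value 0). *)
definition qpoch_inf :: "complex \<Rightarrow> complex \<Rightarrow> complex"
  where "qpoch_inf a p = (\<Prod>j. 1 - a * p ^ j)"

definition qpoch3_inf :: "complex \<Rightarrow> complex \<Rightarrow> complex \<Rightarrow> complex \<Rightarrow> complex"
  where "qpoch3_inf a b c p = qpoch_inf a p * qpoch_inf b p * qpoch_inf c p"

definition qfact :: "complex \<Rightarrow> nat \<Rightarrow> complex"
  where "qfact q n = (\<Prod>j=1..n. 1 - q ^ j)"

(* (q)_inf: the product over j >= 1, shifted to start at 0. *)
definition qfact_inf :: "complex \<Rightarrow> complex"
  where "qfact_inf q = (\<Prod>j. 1 - q ^ Suc j)"

end

theory Submission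
  imports Defs
begin

text \<open>
  Write \<open>(q)\<^sub>n\<close> for \<open>qfact q n\<close> and \<open>P\<close> for \<open>qfact_inf q\<close>.  The summation variables form a
  chain in which only neighbours interact, so the multiple sum can be computed one variable at a
  time: it equals \<open>F (2k) 0\<close>, where \<open>F 0 a = 1\<close> and, with \<open>F L = path_sum q L\<close>,
  \<open>F (L+1) a = \<Sum>b. q^(b (a+1)) / (q)\<^sub>b\<^sup>2 * F L b\<close>.

  The key observation is that two such steps together act as the transpose of a step in the
  Bailey chain.  Put \<open>X k = bailey_weight q k\<close>, so that \<open>X 0 m = (-1)^m q^(m(m+1)/2) (q)\<^sub>m\<close> and
  \<open>X (k+1) r = q^(r\<^sup>2+r) * (\<Sum>m\<ge>r. X k m / (q)\<^bsub>m-r\<^esub>)\<close>.  Then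
  \<open>F (2k) a * P^(2k+1) = (q)\<^sub>a * (\<Sum>r. q^(r a) X k r / (q)\<^sub>r\<^sup>2)\<close>.  For \<open>k = 0\<close> this is Euler's
  expansion of the infinite product \<open>(q^(a+1); q)\<close>; the induction step uses Euler's expansion of
  the reciprocal of such a product and the q-Vandermonde identity
  (\<open>path_step_even_to_odd\<close>, \<open>path_step_odd_to_even\<close>, \<open>path_sum_even\<close>).

  It remains to evaluate \<open>\<Sum>r. X k r / (q)\<^sub>r\<^sup>2\<close>.  Put
  \<open>B n r = bailey_kernel q n r = 1 / ((q)\<^bsub>r-n\<^esub> (q)\<^bsub>r+n+1\<^esub>)\<close>, the kernel of Bailey pairs relative to \<open>q\<close>.  By
  telescoping, \<open>1 / (q)\<^sub>r\<^sup>2 = \<Sum>n. q^(n\<^sup>2) (1 - q^(2n+1)) B n r\<close>, and Bailey's lemma says that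
  replacing \<open>X k\<close> by \<open>X (k+1)\<close> multiplies \<open>\<Sum>r. X k r * B n r\<close> by \<open>q^(n\<^sup>2+n)\<close>; for \<open>k = 0\<close> the
  sum is \<open>(-1)^n q^(n(n+1)/2)\<close>.  Hence the quantity in question is the theta series
  \<open>\<Sum>n. (-1)^n q^(((2k+3) n\<^sup>2 + (2k+1) n)/2) (1 - q^(2n+1))\<close> (\<open>bailey_weight_sum_eq_theta\<close>),
  which the Jacobi triple product identity (\<open>jacobi_triple_product\<close>) turns into the product of the
  statement.
\<close>

section \<open>Dominated double series\<close>

lemma summable_on_product_nonneg:
  fixes u v :: "nat \<Rightarrow> real"
  assumes u: "summable u" "\<And>i. u i \<ge> 0" and v: "summable v" "\<And>j. v j \<ge> 0"
  shows "(\<lambda>(i, j). u i * v j) summable_on UNIV \<times> UNIV"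
proof (rule summable_on_SigmaI[where g = "\<lambda>i. u i * suminf v"])
  fix i
  have "(v has_sum suminf v) UNIV"
    using v by (intro norm_summable_imp_has_sum) (auto simp: summable_sums)
  then show "((\<lambda>y. case (i, y) of (i, j) \<Rightarrow> u i * v j) has_sum u i * suminf v) UNIV"
    by (simp add: has_sum_cmult_right)
next
  show "(\<lambda>i. u i * suminf v) summable_on UNIV"
    using u v by (intro summable_on_cmult_left norm_summable_imp_summable_on) auto
qed (use u v in auto)

lemma dominated_double_series:
  fixes f :: "nat \<Rightarrow> nat \<Rightarrow> complex"
  assumes bound: "\<And>i j. norm (f i j) \<le> u i * v j"
    and u: "summable u" "\<And>i. u i \<ge> 0" and v: "summable v" "\<And>j. v j \<ge> 0"
  shows dominated_summable_on: "(\<lambda>(i, j). f i j) summable_on UNIV \<times> UNIV"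
    and dominated_rows_sums: "(\<lambda>i. \<Sum>j. f i j) sums infsum (\<lambda>(i, j). f i j) (UNIV \<times> UNIV)"
    and dominated_suminf_swap: "(\<Sum>i. \<Sum>j. f i j) = (\<Sum>j. \<Sum>i. f i j)"
proof -
  have rows: "(\<lambda>i. \<Sum>j. g i j) sums infsum (\<lambda>(i, j). g i j) (UNIV \<times> UNIV)
        \<and> (\<lambda>(i, j). g i j) summable_on UNIV \<times> UNIV"
    if bnd: "\<And>i j. norm (g i j) \<le> a i * b j"
    and a: "summable a" "\<And>i. a i \<ge> 0" and b: "summable b" "\<And>j. b j \<ge> 0"
    for g :: "nat \<Rightarrow> nat \<Rightarrow> complex" and a b
  proof -
    have abs: "(\<lambda>(i, j). g i j) summable_on UNIV \<times> UNIV"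
      using bnd
      by (intro abs_summable_summable[OF Infinite_Sum.abs_summable_on_comparison_test'[OF
            summable_on_product_nonneg[OF a b]]]) auto
    have sm: "summable (\<lambda>j. norm (g i j))" for i
      using bnd by (intro summable_comparison_test'[OF summable_mult[OF b(1), of "a i"]]) auto
    have "((\<lambda>i. \<Sum>j. g i j) has_sum infsum (\<lambda>(i, j). g i j) (UNIV \<times> UNIV)) UNIV"
    proof (rule has_sum_Sigma'[where f = "\<lambda>(i, j). g i j" and B = "\<lambda>_. UNIV"])
      show "((\<lambda>(i, j). g i j) has_sum infsum (\<lambda>(i, j). g i j) (UNIV \<times> UNIV)) (UNIV \<times> UNIV)"
        using abs by (intro has_sum_infsum)
      show "((\<lambda>j. case (i, j) of (i, j) \<Rightarrow> g i j) has_sum (\<Sum>j. g i j)) UNIV" for i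
        using sm[of i] by (auto intro!: norm_summable_imp_has_sum summable_sums summable_norm_cancel)
    qed
    then show ?thesis
      using abs by (auto intro: has_sum_imp_sums)
  qed
  note R = rows[of f u v, OF bound u v]
  show "(\<lambda>(i, j). f i j) summable_on UNIV \<times> UNIV"
    "(\<lambda>i. \<Sum>j. f i j) sums infsum (\<lambda>(i, j). f i j) (UNIV \<times> UNIV)"
    using R by auto
  have C: "(\<lambda>j. \<Sum>i. f i j) sums infsum (\<lambda>(j, i). f i j) (UNIV \<times> UNIV)"
    using rows[of "\<lambda>j i. f i j" v u] bound u v by (simp add: mult.commute)
  have "infsum (\<lambda>(j, i). f i j) (UNIV \<times> UNIV) = infsum (\<lambda>(i, j). f i j) (UNIV \<times> UNIV)"
    by (rule infsum_reindex_bij_witness[where i = prod.swap and j = prod.swap]) auto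
  with C R show "(\<Sum>i. \<Sum>j. f i j) = (\<Sum>j. \<Sum>i. f i j)"
    by (auto simp: sums_iff)
qed

section \<open>The shifted factorials\<close>

lemma qfact_0 [simp]: "qfact q 0 = 1"
  by (simp add: qfact_def)

lemma qfact_Suc: "qfact q (Suc n) = (1 - q ^ Suc n) * qfact q n"
  by (simp add: qfact_def mult.commute)

lemma qfact_lessThan: "qfact q n = (\<Prod>j<n. 1 - q ^ Suc j)"
  by (induction n) (auto simp: qfact_Suc)

lemma one_minus_power_nonzero:
  fixes q :: complex
  assumes "norm q < 1" "n > 0"
  shows "1 - q ^ n \<noteq> 0"
proof
  assume "1 - q ^ n = 0"
  then have "norm (q ^ n) = 1" by (metis eq_iff_diff_eq_0 norm_one)
  moreover have "norm q ^ n < 1" using assms by (simp add: power_less_one_iff)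
  ultimately show False by (simp add: norm_power)
qed

lemma qfact_nonzero [simp]: "norm q < 1 \<Longrightarrow> qfact q n \<noteq> 0"
  unfolding qfact_def using one_minus_power_nonzero[of q] by (subst prod_zero_iff) auto

lemma convergent_prod_qpoch:
  assumes "norm (p :: complex) < 1"
  shows "convergent_prod (\<lambda>j. 1 - a * p ^ j)"
proof -
  have "summable (\<lambda>i. norm a * norm p ^ i)"
    using assms by (intro summable_mult summable_geometric) auto
  then have "abs_convergent_prod (\<lambda>j. 1 - a * p ^ j)"
    unfolding abs_convergent_prod_conv_summable by (simp add: norm_mult norm_power)
  then show ?thesis by (rule abs_convergent_prod_imp_convergent_prod)
qed

lemma qpoch_inf_LIMSEQ:
  assumes "norm p < 1"
  shows "(\<lambda>n. \<Prod>j<n. 1 - a * p ^ j) \<longlonglongrightarrow> qpoch_inf a p"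
proof -
  have "(\<lambda>n. \<Prod>j<Suc n. 1 - a * p ^ j) \<longlonglongrightarrow> qpoch_inf a p"
    using convergent_prod_LIMSEQ[OF convergent_prod_qpoch[OF assms, of a]]
    unfolding qpoch_inf_def lessThan_Suc_atMost .
  then show ?thesis by (rule LIMSEQ_imp_Suc)
qed

lemma qfact_inf_eq_qpoch_inf: "qfact_inf q = qpoch_inf q q"
  by (simp add: qfact_inf_def qpoch_inf_def)

lemma qfact_LIMSEQ:
  assumes "norm q < 1"
  shows "qfact q \<longlonglongrightarrow> qfact_inf q"
  using qpoch_inf_LIMSEQ[OF assms, of q]
  by (simp add: qfact_inf_eq_qpoch_inf qfact_lessThan[abs_def])

lemma qfact_inf_nonzero [simp]:
  assumes "norm q < 1"
  shows "qfact_inf q \<noteq> 0"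
  unfolding qfact_inf_def
proof (rule prodinf_nonzero)
  show "convergent_prod (\<lambda>j. 1 - q ^ Suc j)"
    using convergent_prod_qpoch[OF assms, of q] by simp
  show "1 - q ^ Suc i \<noteq> 0" for i
    using one_minus_power_nonzero[OF assms, of "Suc i"] by simp
qed

lemma qfact_mult_qpoch_inf:
  assumes "norm q < 1"
  shows "qfact q n * qpoch_inf (q ^ Suc n) q = qfact_inf q"
proof -
  have "(\<Prod>j. 1 - q * q ^ j) = (\<Prod>j. 1 - q * q ^ (j + n)) * (\<Prod>j<n. 1 - q * q ^ j)"
    using convergent_prod_qpoch[OF assms, of q] one_minus_power_nonzero[OF assms, of "Suc _"]
    by (intro prodinf_split_initial_segment) auto
  then show ?thesis
    by (simp add: qfact_inf_eq_qpoch_inf qpoch_inf_def qfact_lessThan power_add mult_ac)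
qed

lemma qpoch_inf_Suc_eq:
  assumes q: "norm q < 1"
  shows "qpoch_inf (q ^ Suc n) q = qfact_inf q / qfact q n"
  using qfact_mult_qpoch_inf[OF q, of n] q by (simp add: field_simps)

lemma qfact_bounds:
  assumes "norm q < 1"
  obtains M where "M > 0" "\<And>n. norm (qfact q n) \<le> M" "\<And>n. norm (1 / qfact q n) \<le> M"
proof -
  have "Bseq (qfact q)"
    using qfact_LIMSEQ[OF assms] convergent_def convergent_imp_Bseq by blast
  then obtain A where A: "A > 0" "\<And>n. norm (qfact q n) \<le> A" by (auto elim: BseqE)
  have "(\<lambda>n. 1 / qfact q n) \<longlonglongrightarrow> 1 / qfact_inf q"
    using assms by (intro tendsto_divide tendsto_const qfact_LIMSEQ) auto
  then have "Bseq (\<lambda>n. 1 / qfact q n)"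
    using convergent_def convergent_imp_Bseq by blast
  then obtain B where B: "B > 0" "\<And>n. norm (1 / qfact q n) \<le> B" by (auto elim: BseqE)
  show ?thesis
  proof (rule that[of "max A B"])
    show "norm (qfact q n) \<le> max A B" "norm (1 / qfact q n) \<le> max A B" for n
      using A(2)[of n] B(2)[of n] by (meson max.cobounded1 max.cobounded2 order_trans)+
  qed (use A in auto)
qed

lemma norm_power_le_one:
  fixes p :: complex
  assumes "norm p < 1" shows "norm (p ^ n) \<le> 1"
  using assms by (simp add: norm_power power_le_one)

lemma norm_power_le_power_norm:
  fixes q :: complex
  assumes "norm q < 1" "m \<le> n"
  shows "norm (q ^ n) \<le> norm q ^ m"
  using assms by (simp add: norm_power power_decreasing)

lemma choose_two_Suc: "Suc m choose 2 = m + (m choose 2)"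
  by (simp add: numeral_2_eq_2)

section \<open>Euler's expansions of infinite products\<close>

text \<open>
  In both cases the power series satisfies the same functional equation under \<open>z \<mapsto> z p\<close> as the
  product or its reciprocal, and is continuous at \<open>0\<close> with value \<open>1\<close>; iterating the equation gives
  the partial products.
\<close>

lemma summable_bounded_coeffs:
  fixes c :: "nat \<Rightarrow> complex"
  assumes "\<And>n. norm (c n) \<le> M" "norm z < 1"
  shows "summable (\<lambda>n. c n * z ^ n)"
proof (rule summable_comparison_test'[where N = 0])
  show "summable (\<lambda>n. M * norm z ^ n)"
    using assms by (intro summable_mult summable_geometric) auto
qed (use assms in \<open>auto simp: norm_mult norm_power intro!: mult_right_mono\<close>)

lemma bounded_coeffs_tendsto:
  fixes c :: "nat \<Rightarrow> complex"
  assumes c: "\<And>n. norm (c n) \<le> M" and w: "w \<longlonglongrightarrow> 0"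
  shows "(\<lambda>N. \<Sum>n. c n * w N ^ n) \<longlonglongrightarrow> c 0"
proof -
  have "isCont (\<lambda>x. \<Sum>n. c n * x ^ n) 0"
    by (rule isCont_powser[where K = "1/2"])
       (use c in \<open>auto intro!: summable_bounded_coeffs[of c M]\<close>)
  from isCont_tendsto_compose[OF this w] show ?thesis by simp
qed

lemma tendsto_mult_power_zero:
  fixes p z :: complex
  assumes "norm p < 1"
  shows "(\<lambda>N. z * p ^ N) \<longlonglongrightarrow> 0"
  using tendsto_mult_right_zero[OF LIMSEQ_power_zero[OF assms]] by simp

lemma euler_inverse_product:
  fixes p z :: complex
  assumes p: "norm p < 1" and z: "norm z < 1"
  shows "(\<lambda>n. z ^ n / qfact p n) sums (1 / qpoch_inf z p)" and "qpoch_inf z p \<noteq> 0"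
proof -
  obtain M where M: "M > 0" "\<And>n. norm (1 / qfact p n) \<le> M"
    using qfact_bounds[OF p] by metis
  define e where "e = (\<lambda>z. \<Sum>n. 1 / qfact p n * z ^ n)"
  have sm: "summable (\<lambda>n. 1 / qfact p n * z ^ n)" if "norm z < 1" for z
    using M that by (intro summable_bounded_coeffs)
  have nz: "norm (z * p ^ N) < 1" for N
    using z norm_power_le_one[OF p, of N]
    by (simp add: norm_mult) (metis mult_left_le norm_ge_zero order.strict_trans1)
  have step: "(1 - z) * e z = e (z * p)" if z: "norm z < 1" for z
  proof -
    have zp: "norm (z * p) < 1"
      using z p by (simp add: norm_mult) (metis mult_left_le norm_ge_zero order.strict_trans1 less_imp_le)
    have "e z - e (z * p) = (\<Sum>n. 1 / qfact p n * z ^ n - 1 / qfact p n * (z * p) ^ n)"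
      unfolding e_def by (rule suminf_diff[OF sm[OF z] sm[OF zp]])
    also have "\<dots> = (\<Sum>n. 1 / qfact p (Suc n) * z ^ Suc n - 1 / qfact p (Suc n) * (z * p) ^ Suc n)"
      using suminf_split_head[OF summable_diff[OF sm[OF z] sm[OF zp]]] by simp
    also have "\<dots> = (\<Sum>n. z * (1 / qfact p n * z ^ n))"
    proof (intro suminf_cong)
      fix n
      have "1 - p ^ Suc n \<noteq> 0" by (rule one_minus_power_nonzero[OF p]) auto
      then show "1 / qfact p (Suc n) * z ^ Suc n - 1 / qfact p (Suc n) * (z * p) ^ Suc n
          = z * (1 / qfact p n * z ^ n)"
        using p unfolding qfact_Suc power_mult_distrib
        by (simp add: divide_simps) (simp add: algebra_simps)
    qed
    also have "\<dots> = z * e z"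
      unfolding e_def by (rule suminf_mult[OF sm[OF z]])
    finally show ?thesis by (simp add: algebra_simps)
  qed
  have iter: "(\<Prod>j<N. 1 - z * p ^ j) * e z = e (z * p ^ N)" for N
  proof (induction N)
    case (Suc N)
    have "(\<Prod>j<Suc N. 1 - z * p ^ j) * e z = (1 - z * p ^ N) * ((\<Prod>j<N. 1 - z * p ^ j) * e z)"
      by simp
    also have "\<dots> = e (z * p ^ Suc N)"
      unfolding Suc using step[OF nz[of N]] by (simp add: mult_ac)
    finally show ?case .
  qed simp
  have "(\<lambda>N. e (z * p ^ N)) \<longlonglongrightarrow> 1"
    using bounded_coeffs_tendsto[of "\<lambda>n. 1 / qfact p n" M "\<lambda>N. z * p ^ N"] M tendsto_mult_power_zero[OF p]
    by (simp add: e_def)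
  moreover have "(\<lambda>N. e (z * p ^ N)) \<longlonglongrightarrow> qpoch_inf z p * e z"
    unfolding iter[symmetric] by (intro tendsto_mult qpoch_inf_LIMSEQ p tendsto_const)
  ultimately have *: "qpoch_inf z p * e z = 1"
    using LIMSEQ_unique by blast
  then show "qpoch_inf z p \<noteq> 0" by auto
  with * have "e z = 1 / qpoch_inf z p" by (simp add: field_simps)
  then show "(\<lambda>n. z ^ n / qfact p n) sums (1 / qpoch_inf z p)"
    using summable_sums[OF sm[OF z]] by (simp add: e_def)
qed

lemma euler_product:
  fixes p z :: complex
  assumes p: "norm p < 1" and z: "norm z < 1"
  shows "(\<lambda>n. (-1) ^ n * p ^ (n choose 2) * z ^ n / qfact p n) sums qpoch_inf z p"
proof -
  obtain M where M: "M > 0" "\<And>n. norm (1 / qfact p n) \<le> M"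
    using qfact_bounds[OF p] by metis
  define c where "c n = (-1) ^ n * p ^ (n choose 2) * (1 / qfact p n)" for n
  have c: "norm (c n) \<le> M" for n
    using mult_mono[OF norm_power_le_one[OF p] M(2)[of n]] unfolding c_def
    by (simp add: norm_mult norm_power norm_divide)
  define e where "e = (\<lambda>z. \<Sum>n. c n * z ^ n)"
  have sm: "summable (\<lambda>n. c n * z ^ n)" if "norm z < 1" for z
    using c that by (intro summable_bounded_coeffs)
  have nz: "norm (z * p ^ N) < 1" for N
    using z norm_power_le_one[OF p, of N]
    by (simp add: norm_mult) (metis mult_left_le norm_ge_zero order.strict_trans1)
  have step: "e z = (1 - z) * e (z * p)" if z: "norm z < 1" for z
  proof -
    have zp: "norm (z * p) < 1"
      using z p by (simp add: norm_mult) (metis mult_left_le norm_ge_zero order.strict_trans1 less_imp_le)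
    have "e z - e (z * p) = (\<Sum>n. c n * z ^ n - c n * (z * p) ^ n)"
      unfolding e_def by (rule suminf_diff[OF sm[OF z] sm[OF zp]])
    also have "\<dots> = (\<Sum>n. c (Suc n) * z ^ Suc n - c (Suc n) * (z * p) ^ Suc n)"
      using suminf_split_head[OF summable_diff[OF sm[OF z] sm[OF zp]]] by simp
    also have "\<dots> = (\<Sum>n. - z * (c n * (z * p) ^ n))"
    proof (intro suminf_cong)
      fix n
      have "1 - p ^ Suc n \<noteq> 0" by (rule one_minus_power_nonzero[OF p]) auto
      then show "c (Suc n) * z ^ Suc n - c (Suc n) * (z * p) ^ Suc n = - z * (c n * (z * p) ^ n)"
        using p unfolding qfact_Suc power_mult_distrib c_def choose_two_Suc power_add
        by (simp add: divide_simps) (simp add: algebra_simps)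
    qed
    also have "\<dots> = - z * e (z * p)"
      unfolding e_def by (rule suminf_mult[OF sm[OF zp]])
    finally show ?thesis by (simp add: algebra_simps)
  qed
  have iter: "(\<Prod>j<N. 1 - z * p ^ j) * e (z * p ^ N) = e z" for N
  proof (induction N)
    case (Suc N)
    have "(\<Prod>j<Suc N. 1 - z * p ^ j) * e (z * p ^ Suc N)
        = (\<Prod>j<N. 1 - z * p ^ j) * ((1 - z * p ^ N) * e (z * p ^ N * p))"
      by (simp add: mult_ac)
    also have "\<dots> = e z"
      unfolding step[OF nz[of N], symmetric] Suc ..
    finally show ?case .
  qed simp
  have "(\<lambda>N. e (z * p ^ N)) \<longlonglongrightarrow> 1"
    using bounded_coeffs_tendsto[of c M "\<lambda>N. z * p ^ N"] c tendsto_mult_power_zero[OF p]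
    by (simp add: e_def c_def binomial_eq_0)
  then have "(\<lambda>N. (\<Prod>j<N. 1 - z * p ^ j) * e (z * p ^ N)) \<longlonglongrightarrow> qpoch_inf z p * 1"
    by (intro tendsto_mult qpoch_inf_LIMSEQ p)
  then have "e z = qpoch_inf z p"
    unfolding iter by (simp add: LIMSEQ_const_iff)
  then show ?thesis
    using summable_sums[OF sm[OF z]] by (simp add: e_def c_def)
qed

section \<open>Gaussian binomial coefficients\<close>

text \<open>
  The Gaussian binomial coefficient, as a value at \<open>q\<close> rather than as a polynomial.  The quotient
  of q-factorials makes sense for \<open>norm q < 1\<close>, where no q-factorial vanishes; the value is \<open>0\<close>
  for \<open>j > n\<close>.
\<close>
definition gbinom :: "complex \<Rightarrow> nat \<Rightarrow> nat \<Rightarrow> complex" where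
  "gbinom q n j = (if j \<le> n then qfact q n / (qfact q j * qfact q (n - j)) else 0)"

lemma gbinom_0 [simp]: "norm q < 1 \<Longrightarrow> gbinom q n 0 = 1"
  by (simp add: gbinom_def)

lemma gbinom_pascal:
  assumes q: "norm q < 1"
  shows "gbinom q (Suc n) (Suc j) = gbinom q n j + q ^ Suc j * gbinom q n (Suc j)"
proof (cases "Suc j \<le> n")
  case True
  then obtain d where d: "n = Suc j + d" using le_Suc_ex by blast
  have nz: "1 - q ^ Suc j \<noteq> 0" "1 - q ^ Suc d \<noteq> 0"
    by (rule one_minus_power_nonzero[OF q]; simp)+
  have "gbinom q (Suc n) (Suc j) = (1 - q ^ (Suc j + Suc d)) * qfact q n
      / ((1 - q ^ Suc j) * qfact q j * ((1 - q ^ Suc d) * qfact q d))"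
    unfolding d gbinom_def by (simp add: qfact_Suc)
  also have "\<dots> = qfact q n / (qfact q j * ((1 - q ^ Suc d) * qfact q d))
      + q ^ Suc j * (qfact q n / ((1 - q ^ Suc j) * qfact q j * qfact q d))"
    using nz q unfolding power_add by (simp add: divide_simps) (simp add: algebra_simps)
  also have "\<dots> = gbinom q n j + q ^ Suc j * gbinom q n (Suc j)"
    unfolding d gbinom_def by (simp add: qfact_Suc)
  finally show ?thesis .
next
  case False
  then show ?thesis
    using q by (cases "j = n") (auto simp: gbinom_def)
qed

text \<open>
  A common form of the q-Vandermonde identity and of its limiting case: all that matters about the
  factor \<open>g\<close> is a recursion of the type of Pascal's rule.  It is applied with
  \<open>g c j = gbinom q (e + c) j\<close> and with \<open>g c j = 1 / qfact q j\<close>.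
\<close>
lemma gbinom_sum_recursion:
  assumes q: "norm q < 1"
    and g: "\<And>c j. g c j + q ^ Suc j * g c (Suc j) = g (Suc c) (Suc j)"
  shows "(\<Sum>s\<le>M. q ^ (s * (s + c)) * gbinom q M s * g c (s + c)) = g (M + c) (M + c)"
proof (induction M arbitrary: c)
  case 0
  then show ?case using q by simp
next
  case (Suc M)
  let ?a = "\<lambda>s. q ^ (s * (s + c)) * g c (s + c)"
  have top: "gbinom q M (Suc M) = 0" by (simp add: gbinom_def)
  have "(\<Sum>s\<le>Suc M. q ^ (s * (s + c)) * gbinom q (Suc M) s * g c (s + c))
      = ?a 0 + (\<Sum>s\<le>M. ?a (Suc s) * gbinom q (Suc M) (Suc s))"
    unfolding sum.atMost_Suc_shift using q by (simp add: mult_ac)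
  also have "\<dots> = (?a 0 + (\<Sum>s\<le>M. ?a (Suc s) * q ^ Suc s * gbinom q M (Suc s)))
      + (\<Sum>s\<le>M. ?a (Suc s) * gbinom q M s)"
    by (simp add: gbinom_pascal[OF q] algebra_simps sum.distrib)
  also have "?a 0 + (\<Sum>s\<le>M. ?a (Suc s) * q ^ Suc s * gbinom q M (Suc s))
      = (\<Sum>s\<le>Suc M. ?a s * q ^ s * gbinom q M s)"
    unfolding sum.atMost_Suc_shift using q by simp
  also have "\<dots> = (\<Sum>s\<le>M. ?a s * q ^ s * gbinom q M s)"
    using top by simp
  also have "\<dots> + (\<Sum>s\<le>M. ?a (Suc s) * gbinom q M s)
      = (\<Sum>s\<le>M. q ^ (s * (s + Suc c)) * gbinom q M s * (g c (s + c) + q ^ Suc (s + c) * g c (Suc (s + c))))"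
    unfolding sum.distrib[symmetric]
    by (intro sum.cong refl) (simp add: algebra_simps power_add)
  also have "\<dots> = (\<Sum>s\<le>M. q ^ (s * (s + Suc c)) * gbinom q M s * g (Suc c) (s + Suc c))"
    unfolding g by simp
  also have "\<dots> = g (Suc M + c) (Suc M + c)"
    unfolding Suc.IH by simp
  finally show ?case .
qed

lemma q_vandermonde:
  assumes q: "norm q < 1"
  shows "(\<Sum>s\<le>m. q ^ (s * s) * gbinom q m s * gbinom q e s) = gbinom q (m + e) m"
proof -
  have "(\<Sum>s\<le>m. q ^ (s * (s + 0)) * gbinom q m s * gbinom q (e + 0) (s + 0)) = gbinom q (e + (m + 0)) (m + 0)"
    by (rule gbinom_sum_recursion[OF q, where g = "\<lambda>c j. gbinom q (e + c) j"])
       (simp add: gbinom_pascal[OF q])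
  then show ?thesis by (simp add: add.commute)
qed

lemma q_vandermonde_limit:
  assumes q: "norm q < 1"
  shows "(\<Sum>s\<le>M. q ^ (s * (s + c)) * gbinom q M s / qfact q (s + c)) = 1 / qfact q (M + c)"
proof -
  have "(\<Sum>s\<le>M. q ^ (s * (s + c)) * gbinom q M s * (1 / qfact q (s + c))) = 1 / qfact q (M + c)"
  proof (rule gbinom_sum_recursion[OF q, where g = "\<lambda>c j. 1 / qfact q j"])
    fix j
    have "1 - q ^ Suc j \<noteq> 0" by (rule one_minus_power_nonzero[OF q]) simp
    then show "1 / qfact q j + q ^ Suc j * (1 / qfact q (Suc j)) = 1 / qfact q (Suc j)"
      using q by (simp add: qfact_Suc divide_simps)
  qed
  then show ?thesis by simp
qed

section \<open>The iterated sums\<close>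

text \<open>
  \<open>path_sum q L a\<close> is the sum over all chains of \<open>L\<close> natural numbers in which the last one, \<open>b\<close>, is
  coupled to the external value \<open>a\<close> by a factor \<open>q ^ (b * a)\<close>; the recursion sums over \<open>b\<close>.
\<close>
primrec path_sum :: "complex \<Rightarrow> nat \<Rightarrow> nat \<Rightarrow> complex" where
  "path_sum q 0 a = 1"
| "path_sum q (Suc L) a = (\<Sum>b. q ^ (b * Suc a) / (qfact q b)\<^sup>2 * path_sum q L b)"

text \<open>
  The reciprocal \<open>1 / (q)\<^bsub>m-r\<^esub>\<close>, read as \<open>0\<close> for \<open>r > m\<close>, so that sums over \<open>m \<ge> r\<close> can be taken
  over all \<open>m\<close>.
\<close>
definition qrecip :: "complex \<Rightarrow> nat \<Rightarrow> nat \<Rightarrow> complex" where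
  "qrecip q m r = (if r \<le> m then 1 / qfact q (m - r) else 0)"

text \<open>
  The sequences obtained from \<open>(-1)^m q^(m(m+1)/2) (q)\<^sub>m\<close> by iterating the transpose of the Bailey
  chain \<open>\<beta> \<mapsto> (\<lambda>m. \<Sum>r\<le>m. q^(r\<^sup>2+r) \<beta> r / (q)\<^bsub>m-r\<^esub>)\<close>.
\<close>
primrec bailey_weight :: "complex \<Rightarrow> nat \<Rightarrow> nat \<Rightarrow> complex" where
  "bailey_weight q 0 m = (-1) ^ m * q ^ (Suc m choose 2) * qfact q m"
| "bailey_weight q (Suc k) r = q ^ (r * r + r) * (\<Sum>m. bailey_weight q k m * qrecip q m r)"

lemma qrecip_bound:
  assumes "\<And>n. norm (1 / qfact q n) \<le> M" "M > 0"
  shows "norm (qrecip q m r) \<le> M"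
  using assms by (auto simp: qrecip_def)

lemma summable_norm_bailey_weight:
  assumes q: "norm q < 1"
  shows "summable (\<lambda>m. norm (bailey_weight q k m))"
proof (induction k)
  case 0
  obtain M where M: "M > 0" "\<And>n. norm (qfact q n) \<le> M" using qfact_bounds[OF q] by metis
  show ?case
  proof (rule summable_comparison_test'[where N = 0])
    show "summable (\<lambda>m. norm q ^ m * M)" using q by (intro summable_mult2 summable_geometric) auto
    show "norm (norm (bailey_weight q 0 m)) \<le> norm q ^ m * M" for m
      using mult_mono[OF norm_power_le_power_norm[OF q, of m "Suc m choose 2"] M(2)[of m]]
      by (simp add: norm_mult norm_power choose_two_Suc)
  qed
next
  case (Suc k)
  obtain M where M: "M > 0" "\<And>n. norm (1 / qfact q n) \<le> M" using qfact_bounds[OF q] by metis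
  define S where "S = (\<Sum>m. norm (bailey_weight q k m) * M)"
  have sm: "summable (\<lambda>m. norm (bailey_weight q k m) * M)" using Suc by (rule summable_mult2)
  show ?case
  proof (rule summable_comparison_test'[where N = 0])
    show "summable (\<lambda>m. norm q ^ m * S)" using q by (intro summable_mult2 summable_geometric) auto
    fix r
    have "norm (\<Sum>m. bailey_weight q k m * qrecip q m r) \<le> S"
      unfolding S_def
      by (rule norm_suminf_le[OF _ sm]) (auto simp: norm_mult intro!: mult_left_mono qrecip_bound M)
    then show "norm (norm (bailey_weight q (Suc k) r)) \<le> norm q ^ r * S"
      using mult_mono[OF norm_power_le_power_norm[OF q, of r "r * r + r"]] by (simp add: norm_mult)
  qed
qed

lemma norm_bailey_weight_div_le:
  assumes "\<And>n. norm (1 / qfact q n) \<le> M" "M > 0"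
  shows "norm (bailey_weight q k r / (qfact q r)\<^sup>2) \<le> norm (bailey_weight q k r) * (M * M)"
  using mult_left_mono[OF mult_mono[OF assms(1)[of r] assms(1)[of r]], of "norm (bailey_weight q k r)"] assms(2)
  by (simp add: norm_mult norm_divide power2_eq_square)

text \<open>
  Summing over \<open>d\<close> first produces the series \<open>\<Sum>d. z^d / (q)\<^sub>d\<close> at \<open>z = q^(r+e+1)\<close>, whose value
  is \<open>(q)\<^bsub>r+e\<^esub> / P\<close>.
\<close>
lemma path_step_even_to_odd:
  assumes q: "norm q < 1"
  defines "R \<equiv> \<lambda>k r. bailey_weight q k r / (qfact q r)\<^sup>2"
  shows "(\<lambda>d. q ^ (d * Suc e) / (qfact q d)\<^sup>2 * (qfact q d * (\<Sum>r. q ^ (r * d) * R k r)))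
       sums ((\<Sum>r. R k r * qfact q (r + e)) / qfact_inf q)"
proof -
  obtain M where M: "M > 0" "\<And>n. norm (1 / qfact q n) \<le> M" using qfact_bounds[OF q] by metis
  have R: "norm (R k r) \<le> norm (bailey_weight q k r) * (M * M)" for r
    unfolding R_def by (rule norm_bailey_weight_div_le[OF M(2,1)])
  have sW: "summable (\<lambda>r. norm (bailey_weight q k r) * (M * M))"
    by (intro summable_mult2 summable_norm_bailey_weight q)
  define f where "f d r = q ^ (d * Suc e) / qfact q d * (q ^ (r * d) * R k r)" for d r
  have bound: "norm (f d r) \<le> (norm q ^ d * M) * (norm (bailey_weight q k r) * (M * M))" for d r
  proof -
    have "norm (q ^ (d * Suc e) * (1 / qfact q d)) \<le> norm q ^ d * M"
      unfolding norm_mult using M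
      by (intro mult_mono norm_power_le_power_norm[OF q]) auto
    moreover have "norm (q ^ (r * d) * R k r) \<le> 1 * (norm (bailey_weight q k r) * (M * M))"
      unfolding norm_mult by (intro mult_mono norm_power_le_one[OF q] R) auto
    ultimately show ?thesis
      using M(1) unfolding f_def norm_mult[of "_ / _"] by (intro mult_mono) auto
  qed
  note D = dominated_double_series[OF bound summable_mult2[OF summable_geometric] _ sW]
  have sR: "summable (\<lambda>r. q ^ (r * d) * R k r)" for d
  proof (rule summable_comparison_test'[OF sW, where N = 0])
    show "norm (q ^ (r * d) * R k r) \<le> norm (bailey_weight q k r) * (M * M)" for r
      using mult_mono[OF norm_power_le_one[OF q, of "r * d"] R[of r]] by (simp add: norm_mult)
  qed
  have f_row: "q ^ (d * Suc e) / (qfact q d)\<^sup>2 * (qfact q d * (\<Sum>r. q ^ (r * d) * R k r)) = (\<Sum>r. f d r)" for d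
    unfolding f_def suminf_mult[OF sR] using q by (simp add: power2_eq_square)
  have sums_f: "(\<lambda>d. \<Sum>r. f d r) sums (\<Sum>d. \<Sum>r. f d r)"
    using D(2) q M(1) by (auto simp: sums_iff)
  have "(\<Sum>d. \<Sum>r. f d r) = (\<Sum>r. \<Sum>d. f d r)"
    using D(3) q M(1) by simp
  also have "\<dots> = (\<Sum>r. R k r * qfact q (r + e) * (1 / qfact_inf q))"
  proof (intro suminf_cong)
    fix r
    have "norm (q ^ Suc (r + e)) < 1"
      using norm_power_le_power_norm[OF q, of 1 "Suc (r + e)"] q by simp
    from euler_inverse_product(1)[OF q this]
    have "(\<lambda>d. R k r * ((q ^ Suc (r + e)) ^ d / qfact q d)) sums (R k r * (1 / qpoch_inf (q ^ Suc (r + e)) q))"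
      by (rule sums_mult)
    moreover have "R k r * ((q ^ Suc (r + e)) ^ d / qfact q d) = f d r" for d
    proof -
      have "(q ^ Suc (r + e)) ^ d = q ^ (d * Suc e) * q ^ (r * d)"
        unfolding power_mult[symmetric] power_add[symmetric] by (simp add: algebra_simps)
      then show ?thesis by (simp add: f_def)
    qed
    ultimately show "(\<Sum>d. f d r) = R k r * qfact q (r + e) * (1 / qfact_inf q)"
      by (simp add: sums_iff qpoch_inf_Suc_eq[OF q] del: power_Suc)
  qed
  also have "\<dots> = (\<Sum>r. R k r * qfact q (r + e)) * (1 / qfact_inf q)"
  proof (rule suminf_mult2[symmetric])
    obtain M' where M': "M' > 0" "\<And>n. norm (qfact q n) \<le> M'" using qfact_bounds[OF q] by metis
    show "summable (\<lambda>r. R k r * qfact q (r + e))"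
    proof (rule summable_comparison_test'[OF summable_mult2[OF sW, of M'], where N = 0])
      show "norm (R k r * qfact q (r + e)) \<le> norm (bailey_weight q k r) * (M * M) * M'" for r
        unfolding norm_mult using M'(2) M(1) by (intro mult_mono R) auto
    qed
  qed
  finally show ?thesis using sums_f unfolding f_row by simp
qed

text \<open>
  With \<open>z = q^(d+1)\<close> the summand is \<open>(q)\<^sub>m z^e / (q)\<^sub>e\<close> times a Gaussian binomial coefficient, which
  the q-Vandermonde identity expands into terms whose sums over \<open>e\<close> are again Euler series.
\<close>
lemma qbinomial_geometric_sum:
  assumes q: "norm q < 1"
  shows "(\<lambda>e. q ^ (e * Suc d) / (qfact q e)\<^sup>2 * (qfact q (m + e)))
     sums (qfact q d / qfact_inf q * (\<Sum>r\<le>m. q ^ (r * r + r) * q ^ (r * d) / (qfact q r)\<^sup>2 * ((qfact q m)\<^sup>2 * qrecip q m r)))"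
proof -
  define z where "z = q ^ Suc d"
  have z: "norm z < 1"
    using norm_power_le_power_norm[OF q, of 1 "Suc d"] q by (simp add: z_def)
  have inner: "(\<lambda>e. z ^ e * gbinom q e r / qfact q e) sums (z ^ r / qfact q r * (qfact q d / qfact_inf q))" for r
  proof -
    have "(\<lambda>e. z ^ r / qfact q r * (z ^ e / qfact q e)) sums (z ^ r / qfact q r * (1 / qpoch_inf z q))"
      by (intro sums_mult euler_inverse_product[OF q z])
    moreover have "z ^ r / qfact q r * (z ^ e / qfact q e) = z ^ (e + r) * gbinom q (e + r) r / qfact q (e + r)" for e
      using q by (simp add: gbinom_def power_add)
    moreover have "(\<Sum>e<r. z ^ e * gbinom q e r / qfact q e) = 0"
      by (intro sum.neutral) (auto simp: gbinom_def)
    ultimately show ?thesis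
      using sums_iff_shift[of "\<lambda>e. z ^ e * gbinom q e r / qfact q e" r] 
      by (simp add: z_def qpoch_inf_Suc_eq[OF q] del: power_Suc)
  qed
  have "(\<lambda>e. \<Sum>r\<le>m. qfact q m * q ^ (r * r) * gbinom q m r * (z ^ e * gbinom q e r / qfact q e)) sums
      (\<Sum>r\<le>m. qfact q m * q ^ (r * r) * gbinom q m r * (z ^ r / qfact q r * (qfact q d / qfact_inf q)))"
    by (intro sums_sum sums_mult inner)
  moreover have "(\<Sum>r\<le>m. qfact q m * q ^ (r * r) * gbinom q m r * (z ^ e * gbinom q e r / qfact q e))
      = q ^ (e * Suc d) / (qfact q e)\<^sup>2 * (qfact q (m + e))" for e
  proof -
    have "(\<Sum>r\<le>m. qfact q m * q ^ (r * r) * gbinom q m r * (z ^ e * gbinom q e r / qfact q e))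
       = qfact q m * z ^ e / qfact q e * (\<Sum>r\<le>m. q ^ (r * r) * gbinom q m r * gbinom q e r)"
      unfolding sum_distrib_left by (intro sum.cong) auto
    also have "\<dots> = qfact q m * z ^ e / qfact q e * gbinom q (m + e) m"
      unfolding q_vandermonde[OF q] ..
    also have "\<dots> = q ^ (e * Suc d) / (qfact q e)\<^sup>2 * (qfact q (m + e))"
      using q by (simp add: gbinom_def power2_eq_square z_def power_mult[symmetric] mult.commute del: power_Suc)
    finally show ?thesis .
  qed
  moreover have "(\<Sum>r\<le>m. qfact q m * q ^ (r * r) * gbinom q m r * (z ^ r / qfact q r * (qfact q d / qfact_inf q)))
     = qfact q d / qfact_inf q * (\<Sum>r\<le>m. q ^ (r * r + r) * q ^ (r * d) / (qfact q r)\<^sup>2 * ((qfact q m)\<^sup>2 * qrecip q m r))"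
    unfolding sum_distrib_left
  proof (intro sum.cong refl)
    fix r assume "r \<in> {..m}"
    moreover have "z ^ r = q ^ r * q ^ (r * d)"
      by (simp add: z_def power_mult_distrib power_mult[symmetric] mult.commute)
    ultimately show "qfact q m * q ^ (r * r) * gbinom q m r * (z ^ r / qfact q r * (qfact q d / qfact_inf q))
      = qfact q d / qfact_inf q * (q ^ (r * r + r) * q ^ (r * d) / (qfact q r)\<^sup>2 * ((qfact q m)\<^sup>2 * qrecip q m r))"
      by (simp add: gbinom_def qrecip_def power2_eq_square power_add mult_ac)
  qed
  ultimately show ?thesis by simp
qed

lemma path_step_odd_to_even:
  assumes q: "norm q < 1"
  defines "R \<equiv> \<lambda>k r. bailey_weight q k r / (qfact q r)\<^sup>2"
  shows "(\<lambda>e. q ^ (e * Suc d) / (qfact q e)\<^sup>2 * (\<Sum>m. R k m * qfact q (m + e)))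
       sums (qfact q d * (\<Sum>r. q ^ (r * d) * R (Suc k) r) / qfact_inf q)"
proof -
  obtain M where M: "M > 0" "\<And>n. norm (qfact q n) \<le> M" "\<And>n. norm (1 / qfact q n) \<le> M"
    using qfact_bounds[OF q] by metis
  have R: "norm (R k r) \<le> norm (bailey_weight q k r) * (M * M)" for r
    unfolding R_def by (rule norm_bailey_weight_div_le[OF M(3,1)])
  have MM: "norm (1 / (qfact q e)\<^sup>2) \<le> M * M" for e
    using mult_mono[OF M(3)[of e] M(3)[of e]] M(1) by (simp add: norm_mult norm_divide power2_eq_square)
  have sW: "summable (\<lambda>r. norm (bailey_weight q k r) * C)" for C
    by (intro summable_mult2 summable_norm_bailey_weight q)
  define f where "f e m = q ^ (e * Suc d) / (qfact q e)\<^sup>2 * (R k m * qfact q (m + e))" for e m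
  have Rq: "norm (R k m * qfact q (m + e)) \<le> norm (bailey_weight q k m) * (M * M * M)" for m e
    using mult_mono[OF R[of m] M(2)[of "m + e"]] M(1) by (simp add: norm_mult mult_ac)
  have bound: "norm (f e m) \<le> (norm q ^ e * (M * M)) * (norm (bailey_weight q k m) * (M * M * M))" for e m
  proof -
    have "norm (q ^ (e * Suc d) * (1 / (qfact q e)\<^sup>2)) \<le> norm q ^ e * (M * M)"
      unfolding norm_mult by (intro mult_mono norm_power_le_power_norm[OF q] MM) auto
    then show ?thesis
      using M(1) Rq[of m e] unfolding f_def norm_mult[of "_ / _"] by (intro mult_mono) auto
  qed
  note D = dominated_double_series[OF bound summable_mult2[OF summable_geometric] _ sW]
  have sR: "summable (\<lambda>m. R k m * qfact q (m + e))" for e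
    by (rule summable_comparison_test'[OF sW[of "M * M * M"], where N = 0]) (rule Rq)
  define a where "a r = q ^ (r * r + r) * q ^ (r * d) / (qfact q r)\<^sup>2" for r
  define h where "h m r = a r * (bailey_weight q k m * qrecip q m r)" for m r
  have boundh: "norm (h m r) \<le> norm (bailey_weight q k m) * M * (norm q ^ r * (M * M))" for m r
  proof -
    have "norm (q ^ (r * r + r) * q ^ (r * d) * (1 / (qfact q r)\<^sup>2)) \<le> norm q ^ r * 1 * (M * M)"
      unfolding norm_mult using M(1)
      by (intro mult_mono norm_power_le_power_norm[OF q] norm_power_le_one[OF q] MM) auto
    moreover have "norm (bailey_weight q k m * qrecip q m r) \<le> norm (bailey_weight q k m) * M"
      unfolding norm_mult by (intro mult_left_mono qrecip_bound[OF M(3,1)]) auto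
    ultimately have "norm (a r) * norm (bailey_weight q k m * qrecip q m r)
        \<le> (norm q ^ r * (M * M)) * (norm (bailey_weight q k m) * M)"
      unfolding a_def using M(1) by (intro mult_mono) auto
    then show ?thesis by (simp add: h_def norm_mult mult_ac)
  qed
  note Dh = dominated_double_series[OF boundh sW _ summable_mult2[OF summable_geometric]]
  have h_sum: "(\<Sum>r. h m r) = (\<Sum>r\<le>m. a r * (bailey_weight q k m * qrecip q m r))" for m
    unfolding h_def by (rule suminf_finite) (auto simp: qrecip_def)
  have f_row: "q ^ (e * Suc d) / (qfact q e)\<^sup>2 * (\<Sum>m. R k m * qfact q (m + e)) = (\<Sum>m. f e m)" for e
    unfolding f_def suminf_mult[OF sR] ..
  have sums_f: "(\<lambda>e. \<Sum>m. f e m) sums (\<Sum>e. \<Sum>m. f e m)"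
    using D(2) q M(1) by (auto simp: sums_iff)
  have "(\<Sum>e. \<Sum>m. f e m) = (\<Sum>m. \<Sum>e. f e m)"
    using D(3) q M(1) by simp
  also have "\<dots> = (\<Sum>m. qfact q d / qfact_inf q * (\<Sum>r. h m r))"
  proof (intro suminf_cong)
    fix m
    have "(\<lambda>e. R k m * (q ^ (e * Suc d) / (qfact q e)\<^sup>2 * qfact q (m + e)))
      sums (R k m * (qfact q d / qfact_inf q * (\<Sum>r\<le>m. a r * ((qfact q m)\<^sup>2 * qrecip q m r))))"
      unfolding a_def by (intro sums_mult qbinomial_geometric_sum[OF q])
    moreover have "R k m * (qfact q d / qfact_inf q * (\<Sum>r\<le>m. a r * ((qfact q m)\<^sup>2 * qrecip q m r)))
       = qfact q d / qfact_inf q * (\<Sum>r. h m r)"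
      unfolding h_sum sum_distrib_left
      by (intro sum.cong refl) (use q in \<open>simp add: R_def\<close>)
    ultimately show "(\<Sum>e. f e m) = qfact q d / qfact_inf q * (\<Sum>r. h m r)"
      by (simp add: sums_iff f_def mult_ac)
  qed
  also have "\<dots> = qfact q d / qfact_inf q * (\<Sum>m. \<Sum>r. h m r)"
    using Dh(2) q M(1) by (intro suminf_mult) (auto simp: sums_iff)
  also have "(\<Sum>m. \<Sum>r. h m r) = (\<Sum>r. \<Sum>m. h m r)"
    using Dh(3) q M(1) by simp
  also have "\<dots> = (\<Sum>r. q ^ (r * d) * R (Suc k) r)"
  proof (intro suminf_cong)
    fix r
    have "summable (\<lambda>m. bailey_weight q k m * qrecip q m r)"
      by (rule summable_comparison_test'[OF sW[of M], where N = 0])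
         (auto simp: norm_mult intro!: mult_left_mono qrecip_bound[OF M(3,1)])
    then have "(\<Sum>m. h m r) = a r * (\<Sum>m. bailey_weight q k m * qrecip q m r)"
      unfolding h_def by (rule suminf_mult)
    then show "(\<Sum>m. h m r) = q ^ (r * d) * R (Suc k) r"
      by (simp add: a_def R_def mult_ac)
  qed
  finally show ?thesis using sums_f unfolding f_row by simp
qed

lemma path_sum_even:
  assumes q: "norm q < 1"
  shows "path_sum q (2 * k) a * qfact_inf q ^ (2 * k + 1)
       = qfact q a * (\<Sum>r. q ^ (r * a) * (bailey_weight q k r / (qfact q r)\<^sup>2))"
proof (induction k arbitrary: a)
  case 0
  have "norm (q ^ Suc a) < 1"
    using norm_power_le_power_norm[OF q, of 1 "Suc a"] q by simp
  from euler_product[OF q this]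
  have "(\<lambda>n. (-1) ^ n * q ^ (n choose 2) * (q ^ Suc a) ^ n / qfact q n) sums (qfact_inf q / qfact q a)"
    unfolding qpoch_inf_Suc_eq[OF q] .
  moreover have "(-1) ^ n * q ^ (n choose 2) * (q ^ Suc a) ^ n / qfact q n
      = q ^ (n * a) * (bailey_weight q 0 n / (qfact q n)\<^sup>2)" for n
    using q by (simp add: choose_two_Suc power_add power_mult_distrib power_mult[symmetric]
        power2_eq_square mult_ac)
  ultimately have "(\<Sum>n. q ^ (n * a) * (bailey_weight q 0 n / (qfact q n)\<^sup>2)) = qfact_inf q / qfact q a"
    by (simp add: sums_iff)
  then show ?case using q by (simp del: bailey_weight.simps)
next
  case (Suc k)
  let ?P = "qfact_inf q"
  let ?R = "\<lambda>k r. bailey_weight q k r / (qfact q r)\<^sup>2"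
  have nz: "?P \<noteq> 0" using q by simp
  have even: "path_sum q (2 * k) b = qfact q b * (\<Sum>r. q ^ (r * b) * ?R k r) / ?P ^ (2 * k + 1)" for b
    using Suc[of b] nz by (simp add: field_simps)
  have odd: "path_sum q (Suc (2 * k)) b = (\<Sum>r. ?R k r * qfact q (r + b)) / ?P ^ (2 * k + 2)" for b
  proof -
    have "(\<lambda>d. q ^ (d * Suc b) / (qfact q d)\<^sup>2 * (qfact q d * (\<Sum>r. q ^ (r * d) * ?R k r)) / ?P ^ (2 * k + 1))
        sums ((\<Sum>r. ?R k r * qfact q (r + b)) / ?P / ?P ^ (2 * k + 1))"
      by (intro sums_divide path_step_even_to_odd[OF q])
    then show ?thesis
      unfolding path_sum.simps even times_divide_eq_right by (simp add: sums_iff mult_ac)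
  qed
  have "(\<lambda>e. q ^ (e * Suc a) / (qfact q e)\<^sup>2 * (\<Sum>m. ?R k m * qfact q (m + e)) / ?P ^ (2 * k + 2))
      sums (qfact q a * (\<Sum>r. q ^ (r * a) * ?R (Suc k) r) / ?P / ?P ^ (2 * k + 2))"
    by (intro sums_divide path_step_odd_to_even[OF q])
  then have "path_sum q (Suc (Suc (2 * k))) a = qfact q a * (\<Sum>r. q ^ (r * a) * ?R (Suc k) r) / ?P / ?P ^ (2 * k + 2)"
    unfolding path_sum.simps(2)[of q "Suc (2 * k)"] odd times_divide_eq_right
    by (simp add: sums_iff del: bailey_weight.simps path_sum.simps)
  then show ?case
    using nz by (simp add: field_simps del: bailey_weight.simps path_sum.simps)
qed

section \<open>Evaluation by Bailey pairs\<close>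

text \<open>
  The kernel \<open>1 / ((q)\<^bsub>m-n\<^esub> (q)\<^bsub>m+n+1\<^esub>)\<close> of Bailey pairs relative to \<open>q\<close>, zero for \<open>n > m\<close>.  It
  differs by the constant factor \<open>1 - q\<close> from the customary normalisation, which has the factorial
  \<open>(q\<^sup>2; q)\<^bsub>m+n\<^esub>\<close> in place of \<open>(q)\<^bsub>m+n+1\<^esub>\<close>.
\<close>
definition bailey_kernel :: "complex \<Rightarrow> nat \<Rightarrow> nat \<Rightarrow> complex" where
  "bailey_kernel q n m = qrecip q m n / qfact q (m + n + 1)"

text \<open>
  The sequence \<open>A N = 1 / ((q)\<^bsub>r-N\<^esub> (q)\<^bsub>r+N\<^esub>)\<close> satisfies
  \<open>A N - q^(2N+1) A (N+1) = (1 - q^(2N+1)) / ((q)\<^bsub>r-N\<^esub> (q)\<^bsub>r+N+1\<^esub>)\<close>, and \<open>A 0 = 1 / (q)\<^sub>r\<^sup>2\<close>.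
\<close>
lemma inverse_square_telescope:
  assumes q: "norm q < 1"
  shows "(\<Sum>n<N. q ^ (n * n) * (1 - q ^ (2 * n + 1)) * bailey_kernel q n r)
       = 1 / (qfact q r)\<^sup>2 - q ^ (N * N) * (qrecip q r N / qfact q (r + N))"
proof (induction N)
  case 0
  then show ?case by (simp add: qrecip_def power2_eq_square)
next
  case (Suc N)
  have "q ^ (N * N) * (qrecip q r N / qfact q (r + N)) - q ^ (Suc N * Suc N) * (qrecip q r (Suc N) / qfact q (r + Suc N))
     = q ^ (N * N) * (1 - q ^ (2 * N + 1)) * bailey_kernel q N r"
  proof (cases "N \<le> r")
    case True
    then obtain d where d: "r = N + d" using le_Suc_ex by blast
    have nz: "1 - q ^ (2 * N + d + 1) \<noteq> 0"
      by (rule one_minus_power_nonzero[OF q]) simp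
    have nz': "qfact q (2 * N + d) \<noteq> 0" using q by simp
    have e1: "qfact q (r + N) = qfact q (2 * N + d)"
      "qfact q (r + Suc N) = (1 - q ^ (2 * N + d + 1)) * qfact q (2 * N + d)"
      "qfact q (r + N + 1) = (1 - q ^ (2 * N + d + 1)) * qfact q (2 * N + d)"
    proof -
      have e: "qfact q (2 * N + d + 1) = (1 - q ^ (2 * N + d + 1)) * qfact q (2 * N + d)"
        using qfact_Suc[of q "2 * N + d"] by (simp only: Suc_eq_plus1)
      have i: "r + N = 2 * N + d" "r + Suc N = 2 * N + d + 1" "r + N + 1 = 2 * N + d + 1"
        by (simp_all add: d)
      show "qfact q (r + N) = qfact q (2 * N + d)"
        "qfact q (r + Suc N) = (1 - q ^ (2 * N + d + 1)) * qfact q (2 * N + d)"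
        "qfact q (r + N + 1) = (1 - q ^ (2 * N + d + 1)) * qfact q (2 * N + d)"
        unfolding i by (rule refl e)+
    qed
    have e2: "qrecip q r N = 1 / qfact q d" by (simp add: d qrecip_def)
    have e3: "qrecip q r (Suc N) = (1 - q ^ d) / qfact q d"
    proof (cases d)
      case 0 then show ?thesis by (simp add: d qrecip_def)
    next
      case (Suc d')
      then show ?thesis
        using one_minus_power_nonzero[OF q, of "Suc d'"] q by (simp add: d qrecip_def qfact_Suc del: power_Suc)
    qed
    have "Suc N * Suc N = N * N + (2 * N + 1)" by simp
    then have e4: "q ^ (Suc N * Suc N) = q ^ (N * N) * q ^ (2 * N + 1)"
      by (simp only: power_add)
    have e5: "q ^ (2 * N + d + 1) = q ^ (2 * N + 1) * q ^ d"
      by (simp add: power_add[symmetric] del: power_Suc)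
    have nz'': "qfact q d \<noteq> 0" using q by simp
    show ?thesis
      using nz nz' nz'' unfolding bailey_kernel_def e1 e2 e3 e4 e5
      by (simp add: divide_simps del: power_Suc) (simp add: algebra_simps del: power_Suc)
  qed (auto simp: qrecip_def bailey_kernel_def)
  then have "q ^ (N * N) * (1 - q ^ (2 * N + 1)) * bailey_kernel q N r
     = q ^ (N * N) * (qrecip q r N / qfact q (r + N)) - q ^ (Suc N * Suc N) * (qrecip q r (Suc N) / qfact q (r + Suc N))" ..
  then show ?case
    unfolding sum.lessThan_Suc Suc.IH by (simp only: add_diff_eq diff_add_cancel)
qed

lemma inverse_square_expansion:
  assumes q: "norm q < 1"
  shows "(\<Sum>n. q ^ (n * n) * (1 - q ^ (2 * n + 1)) * bailey_kernel q n r) = 1 / (qfact q r)\<^sup>2"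
proof -
  have "(\<Sum>n. q ^ (n * n) * (1 - q ^ (2 * n + 1)) * bailey_kernel q n r)
      = (\<Sum>n<Suc r. q ^ (n * n) * (1 - q ^ (2 * n + 1)) * bailey_kernel q n r)"
    by (rule suminf_finite) (auto simp: bailey_kernel_def qrecip_def)
  then show ?thesis
    unfolding inverse_square_telescope[OF q] by (simp add: qrecip_def)
qed

text \<open>Bailey's lemma for the kernel: as a function of its last argument it is an
  eigenvector of the Bailey chain, with eigenvalue \<open>q^(n\<^sup>2+n)\<close>.\<close>
lemma bailey_kernel_step:
  assumes q: "norm q < 1"
  shows "(\<Sum>r\<le>m. q ^ (r * r + r) * qrecip q m r * bailey_kernel q n r)
       = q ^ (n * n + n) * bailey_kernel q n m"
proof (cases "n \<le> m")
  case True
  then obtain d where d: "m = n + d" using le_Suc_ex by blast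
  have "(\<Sum>r\<le>m. q ^ (r * r + r) * qrecip q m r * bailey_kernel q n r)
      = (\<Sum>r\<in>{n..m}. q ^ (r * r + r) * qrecip q m r * bailey_kernel q n r)"
    by (rule sum.mono_neutral_right) (auto simp: bailey_kernel_def qrecip_def)
  also have "\<dots> = (\<Sum>s\<le>d. q ^ ((n + s) * (n + s) + (n + s)) * qrecip q m (n + s) * bailey_kernel q n (n + s))"
    by (rule sum.reindex_bij_witness[where i = "\<lambda>s. n + s" and j = "\<lambda>r. r - n"]) (auto simp: d)
  also have "\<dots> = (\<Sum>s\<le>d. q ^ (n * n + n) / qfact q d * (q ^ (s * (s + (2 * n + 1))) * gbinom q d s / qfact q (s + (2 * n + 1))))"
  proof (intro sum.cong refl)
    fix s assume s: "s \<in> {..d}"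
    have e1: "(n + s) * (n + s) + (n + s) = n * n + n + s * (s + (2 * n + 1))"
      by (simp add: algebra_simps)
    have e2: "n + s + n + 1 = s + (2 * n + 1)" by simp
    show "q ^ ((n + s) * (n + s) + (n + s)) * qrecip q m (n + s) * bailey_kernel q n (n + s)
      = q ^ (n * n + n) / qfact q d * (q ^ (s * (s + (2 * n + 1))) * gbinom q d s / qfact q (s + (2 * n + 1)))"
      unfolding bailey_kernel_def e1 e2 power_add[of q "n * n + n"]
      using q s by (simp add: qrecip_def gbinom_def d)
  qed
  also have "\<dots> = q ^ (n * n + n) / qfact q d * (1 / qfact q (d + (2 * n + 1)))"
    unfolding sum_distrib_left[symmetric] q_vandermonde_limit[OF q] ..
  also have "\<dots> = q ^ (n * n + n) * bailey_kernel q n m"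
  proof -
    have i: "m + n + 1 = d + (2 * n + 1)" by (simp add: d)
    show ?thesis unfolding bailey_kernel_def i by (simp add: qrecip_def d)
  qed
  finally show ?thesis .
qed (auto simp: bailey_kernel_def qrecip_def intro!: sum.neutral)

lemma choose_two_add: "Suc (n + s) choose 2 = (Suc n choose 2) + (s choose 2) + Suc n * s"
  by (induction s) (auto simp: choose_two_Suc)

text \<open>
  A confluent case of the q-Gauss summation.  Writing \<open>G n l\<close> for the sum, the splitting
  \<open>1 - q^(n+s+1) = (1 - q^(n+l+s+2)) - q^(n+s+1) (1 - q^(l+1))\<close> gives
  \<open>G (n+1) l = G n l - q^(n+1) (1 - q^(l+1)) G n (l+1)\<close>, and \<open>G 0 l\<close> telescopes.
\<close>
lemma alternating_qfact_sum:
  assumes q: "norm q < 1"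
  shows "(\<lambda>s. (-1) ^ s * q ^ ((s choose 2) + Suc l * s) * qfact q (n + s) / (qfact q s * qfact q (n + Suc l + s)))
     sums (qfact q n / qfact q l)"
proof (induction n arbitrary: l)
  case 0
  obtain M where M: "M > 0" "\<And>n. norm (1 / qfact q n) \<le> M"
    using qfact_bounds[OF q] by metis
  define u where "u s = (-1) ^ s * q ^ ((s choose 2) + Suc l * s) * (1 / qfact q (l + s))" for s
  have "u \<longlonglongrightarrow> 0"
  proof (rule Lim_null_comparison)
    show "(\<lambda>s. norm q ^ s * M) \<longlonglongrightarrow> 0"
      using q by (intro tendsto_mult_left_zero LIMSEQ_power_zero) auto
    show "\<forall>\<^sub>F s in sequentially. norm (u s) \<le> norm q ^ s * M"
    proof (intro always_eventually allI)
      fix s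
      have "norm (q ^ ((s choose 2) + Suc l * s) * (1 / qfact q (l + s))) \<le> norm q ^ s * M"
        unfolding norm_mult using M by (intro mult_mono norm_power_le_power_norm[OF q]) auto
      then show "norm (u s) \<le> norm q ^ s * M"
        by (simp add: u_def norm_mult norm_power norm_divide)
    qed
  qed
  from telescope_sums'[OF this] have "(\<lambda>s. u s - u (Suc s)) sums (1 / qfact q l)"
    by (simp add: u_def binomial_eq_0)
  moreover have "u s - u (Suc s)
      = (-1) ^ s * q ^ ((s choose 2) + Suc l * s) * qfact q (0 + s) / (qfact q s * qfact q (0 + Suc l + s))" for s
  proof -
    have "(Suc s choose 2) + Suc l * Suc s = ((s choose 2) + Suc l * s) + Suc (l + s)"
      by (simp add: choose_two_Suc)
    moreover have "1 - q ^ Suc (l + s) \<noteq> 0" by (rule one_minus_power_nonzero[OF q]) simp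
    ultimately show ?thesis
      using q unfolding u_def power_add[of q "_ + _"]
      by (simp add: qfact_Suc divide_simps del: power_Suc) (simp add: algebra_simps power_add)
  qed
  ultimately show ?case by simp
next
  case (Suc n)
  let ?t = "\<lambda>n l s. (-1) ^ s * q ^ ((s choose 2) + Suc l * s) * qfact q (n + s) / (qfact q s * qfact q (n + Suc l + s))"
  have "(\<lambda>s. ?t n l s - q ^ Suc n * (1 - q ^ Suc l) * ?t n (Suc l) s)
      sums (qfact q n / qfact q l - q ^ Suc n * (1 - q ^ Suc l) * (qfact q n / qfact q (Suc l)))"
    by (intro sums_diff sums_mult Suc)
  moreover have "?t n l s - q ^ Suc n * (1 - q ^ Suc l) * ?t n (Suc l) s = ?t (Suc n) l s" for s
  proof -
    define V where "V = qfact q (n + Suc l + s)"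
    define W where "W = q ^ (n + Suc l + Suc s)"
    have e: "qfact q (n + Suc (Suc l) + s) = (1 - W) * V" "qfact q (Suc n + Suc l + s) = (1 - W) * V"
      using qfact_Suc[of q "n + Suc l + s"] by (simp_all add: V_def W_def)
    have f: "qfact q (Suc n + s) = (1 - q ^ Suc n * q ^ s) * qfact q (n + s)"
      by (simp add: qfact_Suc power_add)
    have p: "q ^ ((s choose 2) + Suc (Suc l) * s) = q ^ ((s choose 2) + Suc l * s) * q ^ s"
      by (simp add: power_add)
    have w: "W = q ^ Suc n * q ^ s * q ^ Suc l" by (simp add: W_def power_add)
    have nz: "1 - W \<noteq> 0" unfolding W_def by (rule one_minus_power_nonzero[OF q]) simp
    have nz': "V \<noteq> 0" "qfact q s \<noteq> 0" using q by (simp_all add: V_def)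
    show ?thesis
      unfolding e f p V_def[symmetric] using nz nz'
      by (simp add: divide_simps del: power_Suc) (simp add: w algebra_simps del: power_Suc)
  qed
  moreover have "qfact q n / qfact q l - q ^ Suc n * (1 - q ^ Suc l) * (qfact q n / qfact q (Suc l))
      = qfact q (Suc n) / qfact q l"
    using q one_minus_power_nonzero[OF q, of "Suc l"] unfolding qfact_Suc
    by (simp add: divide_simps del: power_Suc) (simp add: algebra_simps del: power_Suc)
  ultimately show ?case by simp
qed

lemma bailey_weight_0_kernel_sum:
  assumes q: "norm q < 1"
  shows "(\<Sum>m. bailey_weight q 0 m * bailey_kernel q n m) = (-1) ^ n * q ^ (Suc n choose 2)"
proof -
  have "(\<lambda>s. (-1) ^ n * q ^ (Suc n choose 2) * ((-1) ^ s * q ^ ((s choose 2) + Suc n * s) * qfact q (n + s)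
        / (qfact q s * qfact q (n + Suc n + s)))) sums ((-1) ^ n * q ^ (Suc n choose 2) * (qfact q n / qfact q n))"
    by (intro sums_mult alternating_qfact_sum[OF q])
  moreover have "(-1) ^ n * q ^ (Suc n choose 2) * ((-1) ^ s * q ^ ((s choose 2) + Suc n * s) * qfact q (n + s)
        / (qfact q s * qfact q (n + Suc n + s))) = bailey_weight q 0 (s + n) * bailey_kernel q n (s + n)" for s
    using choose_two_add[of n s]
    by (simp add: bailey_kernel_def qrecip_def power_add ac_simps del: power_Suc mult_Suc)
  moreover have "(\<Sum>m<n. bailey_weight q 0 m * bailey_kernel q n m) = 0"
    by (intro sum.neutral) (auto simp: bailey_kernel_def qrecip_def)
  ultimately show ?thesis
    using sums_iff_shift[of "\<lambda>m. bailey_weight q 0 m * bailey_kernel q n m" n] q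
    by (simp add: sums_iff del: bailey_weight.simps)
qed

lemma bailey_kernel_bound:
  assumes "\<And>n. norm (1 / qfact q n) \<le> M" "M > 0"
  shows "norm (bailey_kernel q n m) \<le> M * M"
  using mult_mono[OF qrecip_bound[OF assms, of m n] assms(1)[of "m + n + 1"]] assms(2)
  by (simp add: bailey_kernel_def norm_mult norm_divide)

lemma bailey_weight_kernel_sum:
  assumes q: "norm q < 1"
  shows "(\<Sum>m. bailey_weight q k m * bailey_kernel q n m) = q ^ (k * (n * n + n)) * ((-1) ^ n * q ^ (Suc n choose 2))"
proof (induction k)
  case 0
  then show ?case using bailey_weight_0_kernel_sum[OF q] by simp
next
  case (Suc k)
  obtain M where M: "M > 0" "\<And>n. norm (1 / qfact q n) \<le> M"
    using qfact_bounds[OF q] by metis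
  have sW: "summable (\<lambda>r. norm (bailey_weight q k r) * C)" for C
    by (intro summable_mult2 summable_norm_bailey_weight q)
  define f where "f r m = q ^ (r * r + r) * bailey_kernel q n r * (bailey_weight q k m * qrecip q m r)" for r m
  have bound: "norm (f r m) \<le> (norm q ^ r * (M * M)) * (norm (bailey_weight q k m) * M)" for r m
    unfolding f_def norm_mult using M(1)
    by (intro mult_mono norm_power_le_power_norm[OF q] bailey_kernel_bound[OF M(2,1)] qrecip_bound[OF M(2,1)]) auto
  note D = dominated_double_series[OF bound summable_mult2[OF summable_geometric] _ sW]
  have "(\<Sum>r. bailey_weight q (Suc k) r * bailey_kernel q n r) = (\<Sum>r. \<Sum>m. f r m)"
  proof (intro suminf_cong)
    fix r
    have "summable (\<lambda>m. bailey_weight q k m * qrecip q m r)"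
      by (rule summable_comparison_test'[OF sW[of M], where N = 0])
         (auto simp: norm_mult intro!: mult_left_mono qrecip_bound[OF M(2,1)])
    then show "bailey_weight q (Suc k) r * bailey_kernel q n r = (\<Sum>m. f r m)"
      unfolding f_def by (subst suminf_mult) (auto simp: mult_ac)
  qed
  also have "\<dots> = (\<Sum>m. \<Sum>r. f r m)" using D(3) q M(1) by simp
  also have "\<dots> = (\<Sum>m. q ^ (n * n + n) * (bailey_weight q k m * bailey_kernel q n m))"
  proof (intro suminf_cong)
    fix m
    have "(\<Sum>r. f r m) = (\<Sum>r\<le>m. f r m)"
      by (rule suminf_finite) (auto simp: f_def qrecip_def)
    also have "\<dots> = bailey_weight q k m * (\<Sum>r\<le>m. q ^ (r * r + r) * qrecip q m r * bailey_kernel q n r)"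
      unfolding sum_distrib_left f_def by (intro sum.cong) auto
    finally show "(\<Sum>r. f r m) = q ^ (n * n + n) * (bailey_weight q k m * bailey_kernel q n m)"
      by (simp add: bailey_kernel_step[OF q])
  qed
  also have "\<dots> = q ^ (n * n + n) * (\<Sum>m. bailey_weight q k m * bailey_kernel q n m)"
  proof (rule suminf_mult)
    show "summable (\<lambda>m. bailey_weight q k m * bailey_kernel q n m)"
      by (rule summable_comparison_test'[OF sW[of "M * M"], where N = 0])
         (auto simp: norm_mult intro!: mult_left_mono bailey_kernel_bound[OF M(2,1)])
  qed
  finally show ?case unfolding Suc by (simp add: power_add mult_ac)
qed

lemma bailey_weight_sum_eq_theta:
  assumes q: "norm q < 1"
  shows "(\<Sum>r. bailey_weight q k r / (qfact q r)\<^sup>2)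
       = (\<Sum>n. (-1) ^ n * q ^ ((Suc n choose 2) + n * n + k * (n * n + n)) * (1 - q ^ (2 * n + 1)))"
proof -
  obtain M where M: "M > 0" "\<And>n. norm (1 / qfact q n) \<le> M"
    using qfact_bounds[OF q] by metis
  have sW: "summable (\<lambda>r. norm (bailey_weight q k r) * C)" for C
    by (intro summable_mult2 summable_norm_bailey_weight q)
  define f where "f r n = bailey_weight q k r * (q ^ (n * n) * (1 - q ^ (2 * n + 1)) * bailey_kernel q n r)" for r n
  have "norm (1 - q ^ (2 * n + 1)) \<le> 2" for n
    using norm_triangle_ineq4[of 1 "q ^ (2 * n + 1)"] norm_power_le_one[OF q, of "2 * n + 1"] by simp
  then have bound: "norm (f r n) \<le> (norm (bailey_weight q k r) * 1) * (norm q ^ n * 2 * (M * M))" for r n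
    unfolding f_def norm_mult using M(1)
    by (intro mult_mono norm_power_le_power_norm[OF q] bailey_kernel_bound[OF M(2,1)]) auto
  note D = dominated_double_series[OF bound sW _ summable_mult2[OF summable_mult2[OF summable_geometric]]]
  have "(\<Sum>r. bailey_weight q k r / (qfact q r)\<^sup>2) = (\<Sum>r. \<Sum>n. f r n)"
  proof (intro suminf_cong)
    fix r
    have "summable (\<lambda>n. q ^ (n * n) * (1 - q ^ (2 * n + 1)) * bailey_kernel q n r)"
      by (rule summable_finite[of "{..r}"]) (auto simp: bailey_kernel_def qrecip_def)
    then show "bailey_weight q k r / (qfact q r)\<^sup>2 = (\<Sum>n. f r n)"
      unfolding f_def by (subst suminf_mult) (auto simp only: inverse_square_expansion[OF q] times_divide_eq_right mult_1_right)
  qed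
  also have "\<dots> = (\<Sum>n. \<Sum>r. f r n)" using D(3) q M(1) by simp
  also have "\<dots> = (\<Sum>n. (-1) ^ n * q ^ ((Suc n choose 2) + n * n + k * (n * n + n)) * (1 - q ^ (2 * n + 1)))"
  proof (intro suminf_cong)
    fix n
    have "summable (\<lambda>m. bailey_weight q k m * bailey_kernel q n m)"
      by (rule summable_comparison_test'[OF sW[of "M * M"], where N = 0])
         (auto simp: norm_mult intro!: mult_left_mono bailey_kernel_bound[OF M(2,1)])
    then have "(\<Sum>r. q ^ (n * n) * (1 - q ^ (2 * n + 1)) * (bailey_weight q k r * bailey_kernel q n r))
        = q ^ (n * n) * (1 - q ^ (2 * n + 1)) * (q ^ (k * (n * n + n)) * ((-1) ^ n * q ^ (Suc n choose 2)))"
      by (subst suminf_mult) (auto simp: bailey_weight_kernel_sum[OF q])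
    then show "(\<Sum>r. f r n) = (-1) ^ n * q ^ ((Suc n choose 2) + n * n + k * (n * n + n)) * (1 - q ^ (2 * n + 1))"
      unfolding f_def by (simp add: power_add mult_ac del: power_Suc)
  qed
  finally show ?thesis .
qed

section \<open>The Jacobi triple product\<close>

text \<open>
  For \<open>c = 0\<close> this is the count of partitions by the size of their Durfee square.  The sum \<open>T c\<close> does
  not depend on \<open>c\<close>, and its terms beyond the first are \<open>O(norm p ^ c)\<close>, so its value is the
  limit of the first term \<open>1 / (p)\<^sub>c\<close>.
\<close>
lemma cauchy_durfee_sum:
  assumes p: "norm p < 1"
  shows "(\<lambda>s. p ^ (s * (s + c)) / (qfact p s * qfact p (s + c))) sums (1 / qfact_inf p)"
proof -
  obtain M where M: "M > 0" "\<And>n. norm (1 / qfact p n) \<le> M" using qfact_bounds[OF p] by metis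
  define t where "t c s = p ^ (s * (s + c)) / (qfact p s * qfact p (s + c))" for c s
  define T where "T c = (\<Sum>s. t c s)" for c
  have MM: "norm (1 / (qfact p i * qfact p j)) \<le> M * M" for i j
    using mult_mono[OF M(2)[of i] M(2)[of j]] M(1) by (simp add: norm_mult norm_divide)
  have t_le: "norm (t c s) \<le> norm p ^ s * (M * M)" for c s
  proof -
    have "norm (p ^ (s * (s + c)) * (1 / (qfact p s * qfact p (s + c)))) \<le> norm p ^ s * (M * M)"
      unfolding norm_mult[of "_ ^ _"] by (intro mult_mono norm_power_le_power_norm[OF p] MM) auto
    then show ?thesis by (simp add: t_def)
  qed
  have sm: "summable (t c)" for c
    by (rule summable_comparison_test'[OF summable_mult2[OF summable_geometric] t_le]) (use p in auto)
  have shift: "T c = T (Suc c)" for c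
  proof -
    \<comment> \<open>In the limit, Pascal's rule becomes \<open>1/(p)\<^sub>s = 1/(p)\<^bsub>s-1\<^esub> + p^s/(p)\<^sub>s\<close>; \<open>b\<close> collects the
      contribution of the last term.\<close>
    define b where "b s = p ^ (s * (s + Suc c)) / (qfact p s * qfact p (s + c))" for s
    have b_le: "norm (b s) \<le> norm p ^ s * (M * M)" for s
    proof -
      have "norm (p ^ (s * (s + Suc c)) * (1 / (qfact p s * qfact p (s + c)))) \<le> norm p ^ s * (M * M)"
        unfolding norm_mult[of "_ ^ _"] by (intro mult_mono norm_power_le_power_norm[OF p] MM) auto
      then show ?thesis by (simp add: b_def)
    qed
    have sb: "summable b"
      by (rule summable_comparison_test'[OF summable_mult2[OF summable_geometric] b_le]) (use p in auto)
    have tb: "t c (Suc s) - b (Suc s) = t (Suc c) s - b s" for s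
    proof -
      have e: "Suc s * (Suc s + c) = s * (s + Suc c) + Suc (s + c)"
        "Suc s * (Suc s + Suc c) = s * (s + Suc c) + Suc (s + c) + Suc s"
        by (simp_all add: algebra_simps)
      have f: "qfact p (Suc s + c) = (1 - p ^ Suc (s + c)) * qfact p (s + c)"
        "qfact p (s + Suc c) = (1 - p ^ Suc (s + c)) * qfact p (s + c)"
        by (simp_all add: qfact_Suc)
      have nz: "1 - p ^ Suc (s + c) \<noteq> 0" "1 - p ^ Suc s \<noteq> 0"
        by (rule one_minus_power_nonzero[OF p]; simp)+
      show ?thesis
        using nz p unfolding t_def b_def e f qfact_Suc[of p s] power_add[of p "_ + _"] power_add[of p "s * _"]
        by (simp add: divide_simps del: power_Suc) (simp add: algebra_simps del: power_Suc)
    qed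
    have "T c - suminf b = (\<Sum>s. t c s - b s)"
      unfolding T_def by (rule suminf_diff[OF sm sb])
    also have "\<dots> = (\<Sum>s. t c (Suc s) - b (Suc s))"
      using suminf_split_head[OF summable_diff[OF sm sb], of c] by (simp add: t_def b_def)
    also have "\<dots> = T (Suc c) - suminf b"
      unfolding tb T_def by (rule suminf_diff[OF sm sb, symmetric])
    finally show ?thesis by simp
  qed
  have const: "T c = T 0" for c by (induction c) (auto simp: shift[symmetric])
  have "(\<lambda>c. T c - 1 / qfact p c) \<longlonglongrightarrow> 0"
  proof (rule Lim_null_comparison)
    show "(\<lambda>c. norm p ^ c * (\<Sum>s. norm p ^ s * (M * M))) \<longlonglongrightarrow> 0"
      using p by (intro tendsto_mult_left_zero LIMSEQ_power_zero) auto
    show "\<forall>\<^sub>F c in sequentially. norm (T c - 1 / qfact p c) \<le> norm p ^ c * (\<Sum>s. norm p ^ s * (M * M))"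
    proof (intro always_eventually allI)
      fix c
      have S: "summable (\<lambda>s. norm p ^ s * (M * M))"
        using p by (intro summable_mult2 summable_geometric) auto
      have "T c - 1 / qfact p c = (\<Sum>s. t c (Suc s))"
        unfolding T_def suminf_split_head[OF sm] by (simp add: t_def)
      also have "norm \<dots> \<le> (\<Sum>s. norm p ^ c * (norm p ^ s * (M * M)))"
      proof (rule norm_suminf_le[OF _ summable_mult[OF S]])
        fix s
        have "norm (p ^ (Suc s * (Suc s + c)) * (1 / (qfact p (Suc s) * qfact p (Suc s + c))))
            \<le> norm p ^ (c + s) * (M * M)"
          unfolding norm_mult[of "_ ^ _"] by (intro mult_mono norm_power_le_power_norm[OF p] MM) auto
        then show "norm (t c (Suc s)) \<le> norm p ^ c * (norm p ^ s * (M * M))"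
          by (simp add: t_def power_add mult_ac)
      qed
      also have "\<dots> = norm p ^ c * (\<Sum>s. norm p ^ s * (M * M))"
        by (rule suminf_mult[OF S])
      finally show "norm (T c - 1 / qfact p c) \<le> norm p ^ c * (\<Sum>s. norm p ^ s * (M * M))" .
    qed
  qed
  moreover have "(\<lambda>c. T c - 1 / qfact p c) \<longlonglongrightarrow> T 0 - 1 / qfact_inf p"
  proof -
    have "(\<lambda>c. T c - 1 / qfact p c) = (\<lambda>c. T 0 - 1 / qfact p c)"
      by (intro ext) (subst const, rule refl)
    then show ?thesis
      using p by (auto intro!: tendsto_diff tendsto_divide tendsto_const qfact_LIMSEQ)
  qed
  ultimately have "T 0 - 1 / qfact_inf p = 0"
    by (rule LIMSEQ_unique[symmetric])
  then have "T 0 = 1 / qfact_inf p" by simp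
  then show ?thesis
    using summable_sums[OF sm[of c]] const[of c] unfolding T_def t_def by simp
qed

lemma choose_two_split: "(i choose 2) + ((i + n) choose 2) + i = i * (i + n) + (n choose 2)"
proof (induction i)
  case 0
  then show ?case by (simp add: binomial_eq_0)
next
  case (Suc i)
  have "(Suc i choose 2) + ((Suc i + n) choose 2) + Suc i
     = ((i choose 2) + ((i + n) choose 2) + i) + (2 * i + n + 1)"
    by (simp add: choose_two_Suc)
  also have "\<dots> = Suc i * (Suc i + n) + (n choose 2)"
    unfolding Suc by simp
  finally show ?case .
qed

text \<open>
  In this two-variable form the terms with index \<open>n\<close> and \<open>-n-1\<close> of the bilateral series are
  combined, which avoids negative powers and covers \<open>x = 0\<close> and \<open>y = 0\<close>.  The Euler series of the
  products at \<open>x\<close> and \<open>y\<close> are multiplied and summed along diagonals: on the diagonal at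
  distance \<open>n\<close>, the factor depending on the position \<open>i\<close> is \<open>p^(i(i+n)) / ((p)\<^sub>i (p)\<^bsub>i+n\<^esub>)\<close>.
\<close>
lemma jacobi_triple_product:
  fixes x y :: complex
  assumes x: "norm x < 1" and y: "norm y < 1"
  defines "p \<equiv> x * y"
  shows "qpoch_inf x p * qpoch_inf y p * qpoch_inf p p
       = (\<Sum>n. (-1) ^ n * x ^ (n choose 2) * y ^ (Suc n choose 2) * (1 - x ^ (2 * n + 1)))"
proof -
  have p: "norm p < 1"
    using mult_left_mono[of "norm y" 1 "norm x"] x y by (simp add: p_def norm_mult)
  obtain M where M: "M > 0" "\<And>n. norm (1 / qfact p n) \<le> M" using qfact_bounds[OF p] by metis
  define a where "a z n = (-1) ^ n * p ^ (n choose 2) * z ^ n / qfact p n" for z :: complex and n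
  have a_le: "norm (a z n) \<le> norm z ^ n * M" for z n
    using mult_mono[OF norm_power_le_one[OF p] M(2)[of n], of "n choose 2"] M(1)
      mult_left_mono[of "norm (p ^ (n choose 2)) * norm (1 / qfact p n)" M "norm z ^ n"]
    by (simp add: a_def norm_mult norm_power norm_divide mult_ac)
  define f where "f i j = a x i * a y j" for i j
  have bound: "norm (f i j) \<le> (norm x ^ i * M) * (norm y ^ j * M)" for i j
    unfolding f_def norm_mult using M(1) by (intro mult_mono a_le) auto
  note D = dominated_double_series[OF bound summable_mult2[OF summable_geometric] _ summable_mult2[OF summable_geometric]]
  have summ: "(\<lambda>(i, j). f i j) summable_on UNIV \<times> UNIV"
    using D(1) x y M(1) by simp
  have ax: "a x sums qpoch_inf x p" and ay: "a y sums qpoch_inf y p"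
    unfolding a_def by (rule euler_product[OF p x] euler_product[OF p y])+
  have "(\<lambda>i. \<Sum>j. f i j) sums (qpoch_inf x p * qpoch_inf y p)"
    unfolding f_def using sums_mult2[OF ax] suminf_mult[OF sums_summable[OF ay]] sums_unique[OF ay] by simp
  moreover have "(\<lambda>i. \<Sum>j. f i j) sums infsum (\<lambda>(i, j). f i j) (UNIV \<times> UNIV)"
    using D(2) x y M(1) by simp
  ultimately have tot: "infsum (\<lambda>(i, j). f i j) (UNIV \<times> UNIV) = qpoch_inf x p * qpoch_inf y p"
    by (rule sums_unique2[symmetric])
  \<comment> \<open>Pairs of indices are split into the diagonals \<open>j = i + n\<close> and \<open>i = j + n + 1\<close>.\<close>
  define up where "up n i = f i (i + n)" for n i
  define lo where "lo n j = f (j + Suc n) j" for n j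
  have P: "(\<Sum>i. p ^ (i * (i + n)) / (qfact p i * qfact p (i + n))) = 1 / qfact_inf p"
    "summable (\<lambda>i. p ^ (i * (i + n)) / (qfact p i * qfact p (i + n)))" for n
    using cauchy_durfee_sum[OF p, of n] by (auto simp: sums_iff)
  have diag: "a x' i * a y' (i + n) = (-1) ^ n * p ^ (n choose 2) * y' ^ n * (p ^ (i * (i + n)) / (qfact p i * qfact p (i + n)))"
    if "x' * y' = p" for x' y' i n
  proof -
    have "a x' i * a y' (i + n) = (-1) ^ n * (p ^ ((i choose 2) + ((i + n) choose 2)) * (x' * y') ^ i) * y' ^ n / (qfact p i * qfact p (i + n))"
      by (simp add: a_def power_add power_mult_distrib mult_ac)
    also have "p ^ ((i choose 2) + ((i + n) choose 2)) * (x' * y') ^ i = p ^ (i * (i + n)) * p ^ (n choose 2)"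
      unfolding that power_add[symmetric] choose_two_split ..
    finally show ?thesis by simp
  qed
  have xy: "x * y = p" by (simp add: p_def)
  have up_sum: "(\<Sum>i. up n i) = (-1) ^ n * p ^ (n choose 2) * y ^ n / qfact_inf p" for n
    unfolding up_def f_def diag[OF xy] suminf_mult[OF P(2)] P(1) by simp
  have lo_eq: "lo n j = (-1) ^ Suc n * p ^ (Suc n choose 2) * x ^ Suc n * (p ^ (j * (j + Suc n)) / (qfact p j * qfact p (j + Suc n)))" for n j
    unfolding lo_def f_def using diag[of y x j "Suc n"] by (simp add: p_def mult.commute)
  have lo_sum: "(\<Sum>j. lo n j) = (-1) ^ Suc n * p ^ (Suc n choose 2) * x ^ Suc n / qfact_inf p" for n
    using suminf_mult[OF P(2)[of "Suc n"], of "(-1) ^ Suc n * p ^ (Suc n choose 2) * x ^ Suc n"]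
    by (simp only: lo_eq P(1) times_divide_eq_right mult_1_right)
  let ?U = "range (\<lambda>(n, i). (i, i + n)) :: (nat \<times> nat) set"
  let ?L = "range (\<lambda>(n, j). (j + Suc n, j)) :: (nat \<times> nat) set"
  have UL: "?U \<union> ?L = UNIV"
  proof (intro equalityI subsetI UNIV_I)
    fix ij :: "nat \<times> nat"
    obtain i j where ij: "ij = (i, j)" by fastforce
    show "ij \<in> ?U \<union> ?L"
    proof (cases "i \<le> j")
      case True
      then have "ij = (\<lambda>(n, i). (i, i + n)) (j - i, i)" by (simp add: ij)
      then show ?thesis by blast
    next
      case False
      then have "ij = (\<lambda>(n, j). (j + Suc n, j)) (i - j - 1, j)" by (simp add: ij)
      then show ?thesis by blast
    qed
  qed
  have sub: "(\<lambda>(i, j). f i j) summable_on A" for A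
    by (rule summable_on_subset[of _ UNIV]) (use summ in auto)
  have "infsum (\<lambda>(i, j). f i j) UNIV = infsum (\<lambda>(i, j). f i j) ?U + infsum (\<lambda>(i, j). f i j) ?L"
  proof -
    have "?U \<inter> ?L = {}" by auto
    from infsum_Un_disjoint[OF sub sub this] show ?thesis unfolding UL .
  qed
  also have "infsum (\<lambda>(i, j). f i j) ?U = infsum (\<lambda>(n, i). up n i) UNIV"
    by (subst infsum_reindex) (auto simp: inj_on_def up_def o_def case_prod_unfold)
  also have "infsum (\<lambda>(i, j). f i j) ?L = infsum (\<lambda>(n, j). lo n j) UNIV"
    by (subst infsum_reindex) (auto simp: inj_on_def lo_def o_def case_prod_unfold)
  finally have split: "infsum (\<lambda>(i, j). f i j) UNIV = infsum (\<lambda>(n, i). up n i) UNIV + infsum (\<lambda>(n, j). lo n j) UNIV" .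
  have up_le: "norm (up n i) \<le> (norm y ^ n * M) * (norm x ^ i * M)" for n i
  proof -
    have "norm y ^ (i + n) \<le> norm y ^ n" using y by (intro power_decreasing) auto
    then have "(norm x ^ i * M) * (norm y ^ (i + n) * M) \<le> (norm x ^ i * M) * (norm y ^ n * M)"
      using M(1) by (intro mult_left_mono mult_right_mono) auto
    with bound[of i "i + n"] show ?thesis unfolding up_def by (simp add: mult_ac)
  qed
  have lo_le: "norm (lo n j) \<le> (norm x ^ n * M) * (norm y ^ j * M)" for n j
  proof -
    have "norm x ^ (j + Suc n) \<le> norm x ^ n" using x by (intro power_decreasing) auto
    then have "(norm x ^ (j + Suc n) * M) * (norm y ^ j * M) \<le> (norm x ^ n * M) * (norm y ^ j * M)"
      using M(1) by (intro mult_right_mono) auto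
    with bound[of "j + Suc n" j] show ?thesis unfolding lo_def by simp
  qed
  have U: "(\<lambda>n. \<Sum>i. up n i) sums infsum (\<lambda>(n, i). up n i) UNIV"
    using dominated_double_series(2)[OF up_le summable_mult2[OF summable_geometric] _ summable_mult2[OF summable_geometric]] x y M(1)
    by simp
  have L: "(\<lambda>n. \<Sum>j. lo n j) sums infsum (\<lambda>(n, j). lo n j) UNIV"
    using dominated_double_series(2)[OF lo_le summable_mult2[OF summable_geometric] _ summable_mult2[OF summable_geometric]] x y M(1)
    by simp
  have "(\<lambda>n. qfact_inf p * ((\<Sum>i. up n i) + (\<Sum>j. lo n j))) sums (qfact_inf p * (qpoch_inf x p * qpoch_inf y p))"
    using sums_mult[OF sums_add[OF U L], of "qfact_inf p"] tot split by simp
  moreover have "qfact_inf p * ((\<Sum>i. up n i) + (\<Sum>j. lo n j)) = (-1) ^ n * x ^ (n choose 2) * y ^ (Suc n choose 2) * (1 - x ^ (2 * n + 1))" for n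
  proof -
    have "qfact_inf p * ((\<Sum>i. up n i) + (\<Sum>j. lo n j)) = (-1) ^ n * p ^ (n choose 2) * y ^ n + (-1) ^ Suc n * p ^ (Suc n choose 2) * x ^ Suc n"
      unfolding up_sum lo_sum using p by (simp add: distrib_left del: power_Suc)
    also have "\<dots> = (-1) ^ n * x ^ (n choose 2) * y ^ (Suc n choose 2) * (1 - x ^ (2 * n + 1))"
      by (simp add: p_def choose_two_Suc power_add power_mult_distrib mult_2) (simp add: algebra_simps)
    finally show ?thesis .
  qed
  ultimately show ?thesis
    by (simp add: sums_iff qfact_inf_eq_qpoch_inf mult_ac)
qed

section \<open>The product formula for the iterated sum\<close>

lemma path_sum_even_zero:
  assumes q: "norm q < 1"
  shows "path_sum q (2 * k) 0 = qpoch3_inf q (q ^ (2*k+2)) (q ^ (2*k+3)) (q ^ (2*k+3)) / (qfact_inf q) ^ (2*k+1)"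
proof -
  have y: "norm (q ^ (2 * k + 2)) < 1"
    using norm_power_le_power_norm[OF q, of 1 "2 * k + 2"] q by simp
  have p: "q * q ^ (2 * k + 2) = q ^ (2 * k + 3)"
    by (simp add: numeral_3_eq_3)
  have ex: "(Suc n choose 2) + n * n + k * (n * n + n) = (n choose 2) + (2 * k + 2) * (Suc n choose 2)" for n
  proof (induction n)
    case (Suc n)
    then show ?case by (simp add: choose_two_Suc algebra_simps)
  qed (simp add: binomial_eq_0)
  have "path_sum q (2 * k) 0 * qfact_inf q ^ (2 * k + 1) = (\<Sum>r. bailey_weight q k r / (qfact q r)\<^sup>2)"
    using path_sum_even[OF q, of k 0] by simp
  also have "\<dots> = (\<Sum>n. (-1) ^ n * q ^ (n choose 2) * (q ^ (2 * k + 2)) ^ (Suc n choose 2) * (1 - q ^ (2 * n + 1)))"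
    unfolding bailey_weight_sum_eq_theta[OF q] ex power_add[of q "_ choose _"] power_mult by (simp only: mult.assoc)
  also have "\<dots> = qpoch3_inf q (q ^ (2*k+2)) (q ^ (2*k+3)) (q ^ (2*k+3))"
    unfolding jacobi_triple_product[OF q y, symmetric] p qpoch3_inf_def ..
  finally show ?thesis using q by (simp add: field_simps)
qed

section \<open>From iterated sums to the sum over tuples\<close>

lemma has_sum_PiE_Suc:
  "(f has_sum S) ({1..Suc L} \<rightarrow>\<^sub>E (UNIV :: nat set)) \<longleftrightarrow>
   ((\<lambda>(b, g). f (g(Suc L := b))) has_sum S) (UNIV \<times> ({1..L} \<rightarrow>\<^sub>E (UNIV :: nat set)))"
proof -
  have I: "{1..Suc L} = insert (Suc L) {1..L}" by auto
  have "inj_on (\<lambda>(b, g). g(Suc L := b)) (UNIV \<times> ({1..L} \<rightarrow>\<^sub>E (UNIV :: nat set)))"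
    using inj_combinator[of "Suc L" "{1..L}" "\<lambda>_. UNIV :: nat set"] by simp
  from has_sum_reindex[OF this] show ?thesis
    unfolding I PiE_insert_eq by (simp add: o_def case_prod_unfold)
qed

lemma summable_on_PiE_prod:
  fixes u :: "nat \<Rightarrow> real" and L :: nat
  assumes u: "summable u" "\<And>i. u i \<ge> 0"
  shows "(\<lambda>n. \<Prod>i=1..L. u (n i)) summable_on ({1..L} \<rightarrow>\<^sub>E UNIV)"
proof (induction L)
  case (Suc L)
  then obtain S where S: "((\<lambda>n. \<Prod>i=1..L. u (n i)) has_sum S) ({1..L} \<rightarrow>\<^sub>E UNIV)"
    by (auto simp: summable_on_def)
  have split: "(\<Prod>i=1..Suc L. u ((g(Suc L := b)) i)) = u b * (\<Prod>i=1..L. u (g i))" for g b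
    by simp
  have "(\<lambda>(b, g). u b * (\<Prod>i=1..L. u (g i))) summable_on (UNIV \<times> ({1..L} \<rightarrow>\<^sub>E UNIV))"
  proof (rule summable_on_SigmaI)
    show "((\<lambda>g. case (b, g) of (b, g) \<Rightarrow> u b * (\<Prod>i=1..L. u (g i))) has_sum u b * S) ({1..L} \<rightarrow>\<^sub>E UNIV)" for b
      using has_sum_cmult_right[OF S, of "u b"] by simp
    show "(\<lambda>b. u b * S) summable_on UNIV"
      using u by (intro summable_on_cmult_left norm_summable_imp_summable_on) auto
  qed (use u in \<open>auto intro!: mult_nonneg_nonneg prod_nonneg\<close>)
  then show ?case
    unfolding summable_on_def has_sum_PiE_Suc split .
qed (simp add: summable_on_finite)

text \<open>
  The exponent of \<open>q\<close> contributed by the chain \<open>n 1, ..., n L\<close> with its end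
  \<open>n L\<close> coupled to \<open>a\<close>, following the recursion of \<open>path_sum\<close>.
\<close>
primrec path_exponent :: "nat \<Rightarrow> nat \<Rightarrow> (nat \<Rightarrow> nat) \<Rightarrow> nat" where
  "path_exponent 0 a n = 0"
| "path_exponent (Suc L) a n = n (Suc L) * Suc a + path_exponent L (n (Suc L)) n"

lemma path_exponent_eq:
  "path_exponent (Suc L) a n = (\<Sum>i=1..L. n i * n (i + 1)) + (\<Sum>i=1..Suc L. n i) + n (Suc L) * a"
proof (induction L arbitrary: a)
  case (Suc L)
  have "path_exponent (Suc (Suc L)) a n = n (Suc (Suc L)) * Suc a + path_exponent (Suc L) (n (Suc (Suc L))) n"
    by simp
  then show ?case unfolding Suc by simp
qed simp

lemma path_exponent_cong:
  "(\<And>i. 1 \<le> i \<Longrightarrow> i \<le> L \<Longrightarrow> n i = m i) \<Longrightarrow> path_exponent L a n = path_exponent L a m"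
  by (induction L arbitrary: a) auto

lemma sum_le_path_exponent: "(\<Sum>i=1..L. n i) \<le> path_exponent L a n"
  by (cases L) (simp_all only: path_exponent_eq, simp_all)

text \<open>
  Absolute convergence comes from the bound \<open>\<Prod>i. M\<^sup>2 (norm q)^(n i)\<close> on the terms, where \<open>M\<close> bounds
  the numbers \<open>norm (1 / (q)\<^sub>j)\<close>; it allows the sum over the last index to be split off.
\<close>
lemma has_sum_path_sum:
  assumes q: "norm q < 1"
  shows "((\<lambda>n. q ^ path_exponent L a n / (\<Prod>i=1..L. (qfact q (n i))\<^sup>2)) has_sum path_sum q L a)
     ({1..L} \<rightarrow>\<^sub>E UNIV)"
proof (induction L arbitrary: a)
  case 0
  show ?case by (auto intro!: has_sum_finiteI)
next
  case (Suc L)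
  let ?F = "\<lambda>L a n. q ^ path_exponent L a n / (\<Prod>i=1..L. (qfact q (n i))\<^sup>2)"
  obtain M where M: "M > 0" "\<And>n. norm (1 / qfact q n) \<le> M" using qfact_bounds[OF q] by metis
  have MM: "norm (1 / (qfact q e)\<^sup>2) \<le> M * M" for e
    using mult_mono[OF M(2)[of e] M(2)[of e]] M(1) by (simp add: norm_mult norm_divide power2_eq_square)
  have "?F (Suc L) a summable_on ({1..Suc L} \<rightarrow>\<^sub>E UNIV)"
  proof (rule abs_summable_summable, rule Infinite_Sum.abs_summable_on_comparison_test')
    show "(\<lambda>n. \<Prod>i=1..Suc L. norm q ^ n i * (M * M)) summable_on ({1..Suc L} \<rightarrow>\<^sub>E UNIV)"
      by (rule summable_on_PiE_prod[where u = "\<lambda>j. norm q ^ j * (M * M)"])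
         (use q M(1) in \<open>auto intro!: summable_mult2 summable_geometric\<close>)
    fix n
    have "norm (?F (Suc L) a n) = norm (q ^ path_exponent (Suc L) a n) * (\<Prod>i=1..Suc L. norm (1 / (qfact q (n i))\<^sup>2))"
      by (simp add: norm_divide norm_mult prod_norm prod_dividef)
    also have "\<dots> \<le> norm q ^ (\<Sum>i=1..Suc L. n i) * (\<Prod>i=1..Suc L. M * M)"
      using MM by (intro mult_mono norm_power_le_power_norm[OF q] sum_le_path_exponent prod_mono prod_nonneg) auto
    also have "\<dots> = (\<Prod>i=1..Suc L. norm q ^ n i * (M * M))"
      by (simp only: power_sum prod.distrib)
    finally show "norm (?F (Suc L) a n) \<le> (\<Prod>i=1..Suc L. norm q ^ n i * (M * M))" .
  qed
  then obtain S where S: "(?F (Suc L) a has_sum S) ({1..Suc L} \<rightarrow>\<^sub>E UNIV)"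
    by (auto simp: summable_on_def)
  have F: "?F (Suc L) a (g(Suc L := b)) = q ^ (b * Suc a) / (qfact q b)\<^sup>2 * ?F L b g" for g b
  proof -
    have "path_exponent L b (g(Suc L := b)) = path_exponent L b g"
      by (rule path_exponent_cong) auto
    moreover have "(\<Prod>i=1..Suc L. (qfact q ((g(Suc L := b)) i))\<^sup>2) = (qfact q b)\<^sup>2 * (\<Prod>i=1..L. (qfact q (g i))\<^sup>2)"
      by simp
    ultimately show ?thesis by (simp add: power_add)
  qed
  have "((\<lambda>b. q ^ (b * Suc a) / (qfact q b)\<^sup>2 * path_sum q L b) has_sum S) UNIV"
  proof (rule has_sum_Sigma')
    show "((\<lambda>(b, g). q ^ (b * Suc a) / (qfact q b)\<^sup>2 * ?F L b g) has_sum S) (UNIV \<times> ({1..L} \<rightarrow>\<^sub>E UNIV))"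
      using S unfolding has_sum_PiE_Suc F .
    show "((\<lambda>g. case (b, g) of (b, g) \<Rightarrow> q ^ (b * Suc a) / (qfact q b)\<^sup>2 * ?F L b g) has_sum
        q ^ (b * Suc a) / (qfact q b)\<^sup>2 * path_sum q L b) ({1..L} \<rightarrow>\<^sub>E UNIV)" for b
      using has_sum_cmult_right[OF Suc[of b], of "q ^ (b * Suc a) / (qfact q b)\<^sup>2"] by simp
  qed
  then have "S = path_sum q (Suc L) a"
    using has_sum_imp_sums sums_unique by fastforce
  with S show ?case by simp
qed

theorem theorem5p2:
  fixes q :: complex and k :: nat
  assumes "norm q < 1" and "k \<ge> 1"
  shows "((\<lambda>n. q ^ ((\<Sum>i=1..2*k-1. n i * n (i+1)) + (\<Sum>i=1..2*k. n i))
              / (\<Prod>i=1..2*k. (qfact q (n i))\<^sup>2))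
          has_sum
          (qpoch3_inf q (q ^ (2*k+2)) (q ^ (2*k+3)) (q ^ (2*k+3)) / (qfact_inf q) ^ (2*k+1)))
         ({1..2*k} \<rightarrow>\<^sub>E (UNIV :: nat set))"
proof -
  obtain m where m: "2 * k = Suc m"
    using assms(2) by (cases "2 * k") auto
  have e: "path_exponent (2 * k) 0 n = (\<Sum>i=1..2*k-1. n i * n (i+1)) + (\<Sum>i=1..2*k. n i)" for n
    unfolding m path_exponent_eq diff_Suc_1 mult_0_right add_0_right ..
  show ?thesis
    using has_sum_path_sum[OF assms(1), of "2 * k" 0] unfolding path_sum_even_zero[OF assms(1)] e .
qed

end
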